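(* Let $k\ge1$, $q_n=(p_n,g_n)\in U\times G$ for $n=0,\ldots,N$, and $\lambda^n=(\lambda^n_1,\ldots,\lambda^n_m)\in\mathbb{R}^m$ for $n=0,\ldots,N-k$. Put $W_n=g_n^{-1}g_{n+1}$, $A_n=A(p_n,p_{n+1})$, $\widetilde g_n=W_nA_n$, and $$\tilde a_n=(p_n,p_{n+1},\ldots,p_{n+k},\widetilde g_n,\widetilde g_{n+1},\ldots,\widetilde g_{n+k-1})\in U^{(k+1)}\times G^{k},\qquad n=0,\ldots,N-k.$$ The discrete sequence $\{\tilde a_n,\lambda^n_\alpha\}$ is an extremum (critical point, $\delta\mathcal{S}_d=0$) of the action sum $$\mathcal{S}_d=\sum_{n=0}^{N-k}\Big(\mathcal{L}_d(\tilde a_n)+\lambda^n_\alpha\chi^\alpha_d(\tilde a_n)\Big)$$ with respect to the variations $\delta p_i$ and $$\delta\widetilde g_i=-\eta_iW_iA_i+W_i\eta_{i+1}A_i+W_i\langle D_1A(p_i,p_{i+1}),\delta p_i\rangle+W_i\langle D_2A(p_i,p_{i+1}),\delta p_{i+1}\rangle,\qquad \eta_i=g_i^{-1}\delta g_i\in\mathfrak{g},$$ with $\delta p_i,\eta_i$ arbitrary subject to the endpoint conditions that $q_0,\ldots,q_{k-1}$ and $q_{N-k+1},\ldots,q_N$ are fixed (i.e. $\delta p_i=0$ and $\eta_i=0$ for $0\le i\le k-1$ and $N-k+1\le i\le N$), while the Lagrange multipliers are varied freely, if it is a solution of the discrete constrained higher-order Lagrange-Poincaré equations $$\begin{aligned}0=\;&\sum_{i=1}^{k+1}D_i\mathcal{L}_d(\tilde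 a_{n-i+1})+T^*\hat L_{WA_1}(n)\sum_{z=k+2}^{2k+1}D_z\mathcal{L}_d(\tilde a_{n-z+k+2})+T^*\hat L_{WA_2}(n-1)\sum_{z=k+2}^{2k+1}D_z\mathcal{L}_d(\tilde a_{n-z+k+1})\\&+\sum_{i=1}^{k+1}\lambda^{n-i+1}_\alpha D_i\chi^\alpha_d(\tilde a_{n-i+1})+T^*\hat L_{WA_1}(n)\sum_{z=k+2}^{2k+1}\lambda^{n-z+k+2}_\alpha D_z\chi^\alpha_d(\tilde a_{n-z+k+2})\\&+T^*\hat L_{WA_2}(n-1)\sum_{z=k+2}^{2k+1}\lambda^{n-z+k+1}_\alpha D_z\chi^\alpha_d(\tilde a_{n-z+k+1}),\\ M_n=\;&\mathrm{Ad}^*_{W_{n-1}}M_{n-1}-\sum_{z=k+2}^{2k+1}\lambda^{n-z+k+2}_\alpha\varepsilon^\alpha_{(n,z)}+\mathrm{Ad}^*_{W_{n-1}}\sum_{z=k+2}^{2k+1}\lambda^{n-z+k+1}_\alpha\varepsilon^\alpha_{(n-1,z)}\end{aligned}$$ for $k\le n\le N-k$, together with $0=\chi^\alpha_d(\tilde a_n)$ for $0\le n\le N-k$ and $\alpha=1,\ldots,m$.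
   Context: $G$ is a finite-dimensional Lie group with Lie algebra $\mathfrak{g}$, acting freely and properly on the left on a manifold $Q$ with principal bundle $\pi:Q\to Q/G$. $U\subset Q/G$ is an open set over which the bundle is trivialized, $\pi^{-1}(U)\cong U\times G$, with $G$ acting by left multiplication on the second factor. A discrete connection is a map $\mathcal{A}_d:Q\times Q\to G$ with $\mathcal{A}_d(q_0,gq_0)=g$ and $\mathcal{A}_d(gq_0,hq_1)=h\,\mathcal{A}_d(q_0,q_1)g^{-1}$; $A:U\times U\to G$ is its local representation, $A(p_0,p_1)=\mathcal{A}_d((p_0,e),(p_1,e))$, assumed smooth. $U^{(k+1)}$ is the product of $k+1$ copies of $U$ and $G^k$ the product of $k$ copies of $G$. The class $[q_0,\ldots,q_k]_G$ of $(q_0,\dots,q_k)$ modulo the diagonal $G$-action is represented by $(p_0,\ldots,p_k,\widetilde g_0,\ldots,\widetilde g_{k-1})\in U^{(k+1)}\times G^k$ with $\widetilde g_i=g_i^{-1}g_{i+1}A(p_i,p_{i+1})$, and $\mathcal{L}_d,\chi^\alpha_d:U^{(k+1)}\times G^k\to\mathbb{R}$ ($\alpha=1,\ldots,m$) are smooth functions, the (local expressions of the) discrete reduced higher-order Lagrangian and constraints. Repeated $\alpha$ is summed. $D_i$ is the partial derivative with respect to the $i$-th of the $2k+1$ arguments of $\mathcal{L}_d$ or $\chi_d^\alpha$ (indices $1,\ldots,k+1$ are the $p$-arguments, $k+2,\ldots,2k+1$ the $\widetilde g$-arguments); $D_1A,D_2A$ are the partial derivatives of $A$. Note $D_z\mathcal{L}_d(\tilde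 a_{n-z+k+2})\in T^*_{W_nA_n}G$ for $k+2\le z\le 2k+1$. Products such as $\eta WA$, $W\eta A$, $W\langle D_iA,v\rangle$ denote tangent vectors obtained by applying tangent maps of left and right translations. The covectors $T^*\hat L_{WA_1}(n)\beta$ (for $\beta\in T^*_{W_nA_n}G$) and $T^*\hat L_{WA_2}(n-1)\beta$ (for $\beta\in T^*_{W_{n-1}A_{n-1}}G$) in $T^*_{p_n}U$ are defined by $$\langle T^*\hat L_{WA_1}(n)\beta,\delta p_n\rangle=\langle\beta,W_n\langle D_1A(p_n,p_{n+1}),\delta p_n\rangle\rangle,\qquad\langle T^*\hat L_{WA_2}(n-1)\beta,\delta p_n\rangle=\langle\beta,W_{n-1}\langle D_2A(p_{n-1},p_n),\delta p_n\rangle\rangle.$$ The elements $M_n,\varepsilon^\alpha_{(n,z)}\in\mathfrak{g}^*$ are the right-trivializations $$\langle M_n,\eta\rangle=\Big\langle\sum_{z=k+2}^{2k+1}D_z\mathcal{L}_d(\tilde a_{n-z+k+2}),\eta W_nA_n\Big\rangle,\qquad\langle\varepsilon^\alpha_{(n,z)},\eta\rangle=\langle D_z\chi^\alpha_d(\tilde a_{n-z+k+2}),\eta W_nA_n\rangle,\qquad\eta\in\mathfrak{g},$$ and $\langle\mathrm{Ad}^*_W\mu,\eta\rangle=\langle\mu,\mathrm{Ad}_W\eta\rangle$. *)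

theory Defs
  imports "HOL-Analysis.Analysis" "HOL-Algebra.Group_Action"
begin

section \<open>Smooth manifolds\<close>

text \<open>
  \<open>\<real>\<^sup>n\<close> is the library's \<^const>\<open>Euclidean_space\<close> \<open>n\<close>, whose points are the functions
  \<open>nat \<Rightarrow> real\<close> vanishing from index \<open>n\<close> on. The dimension is thus a number and not a type, so that
  products of a variable number of manifolds can be formed. The set \<open>S\<close> below is meant to be open
  in \<open>\<real>\<^sup>n\<close>; \<open>C_class n S r f\<close> says that all partial derivatives of \<open>f\<close> up to order \<open>r\<close> exist
  and are continuous on \<open>S\<close>.
\<close>

primrec C_class :: "nat \<Rightarrow> (nat \<Rightarrow> real) set \<Rightarrow> nat \<Rightarrow> ((nat \<Rightarrow> real) \<Rightarrow> real) \<Rightarrow> bool" where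
  "C_class n S 0 f \<longleftrightarrow>
     continuous_map (subtopology (Euclidean_space n) S) euclideanreal f"
| "C_class n S (Suc r) f \<longleftrightarrow>
     continuous_map (subtopology (Euclidean_space n) S) euclideanreal f \<and>
     (\<exists>f'. \<forall>j<n.
        (\<forall>x\<in>S. ((\<lambda>t. f (x(j := t))) has_real_derivative f' j x) (at (x j))) \<and>
        C_class n S r (f' j))"

definition C_infinity :: "nat \<Rightarrow> (nat \<Rightarrow> real) set \<Rightarrow> ((nat \<Rightarrow> real) \<Rightarrow> real) \<Rightarrow> bool" where
  "C_infinity n S f \<longleftrightarrow> (\<forall>r. C_class n S r f)"

text \<open>A chart is a pair of its domain and its coordinate map.\<close>

type_synonym 'm chart = "'m set \<times> ('m \<Rightarrow> nat \<Rightarrow> real)"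

record 'm manifold =
  mdim :: nat
  mtop :: "'m topology"
  charts :: "'m chart set"

abbreviation points :: "'m manifold \<Rightarrow> 'm set" where
  "points M \<equiv> topspace (mtop M)"

definition smooth_manifold :: "'m manifold \<Rightarrow> bool" where
  "smooth_manifold M \<longleftrightarrow>
     Hausdorff_space (mtop M) \<and> second_countable (mtop M) \<and>
     (\<Union>(D, \<phi>)\<in>charts M. D) = points M \<and>
     (\<forall>(D, \<phi>)\<in>charts M.
        openin (mtop M) D \<and>
        openin (Euclidean_space (mdim M)) (\<phi> ` D) \<and>
        homeomorphic_map (subtopology (mtop M) D)
          (subtopology (Euclidean_space (mdim M)) (\<phi> ` D)) \<phi>) \<and>
     (\<forall>(D, \<phi>)\<in>charts M. \<forall>(E, \<psi>)\<in>charts M. \<forall>j<mdim M.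
        C_infinity (mdim M) (\<phi> ` (D \<inter> E)) (\<lambda>x. \<psi> (inv_into D \<phi> x) j))"

definition smooth_at :: "'m manifold \<Rightarrow> 'n manifold \<Rightarrow> ('m \<Rightarrow> 'n) \<Rightarrow> 'm \<Rightarrow> bool" where
  "smooth_at M N f p \<longleftrightarrow>
     (\<exists>(D, \<phi>)\<in>charts M. \<exists>(E, \<psi>)\<in>charts N. \<exists>V.
        openin (mtop M) V \<and> p \<in> V \<and> V \<subseteq> D \<and> f ` V \<subseteq> E \<and>
        (\<forall>j<mdim N. C_infinity (mdim M) (\<phi> ` V) (\<lambda>x. \<psi> (f (inv_into D \<phi> x)) j)))"

definition smooth_map :: "'m manifold \<Rightarrow> 'n manifold \<Rightarrow> ('m \<Rightarrow> 'n) \<Rightarrow> bool" where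
  "smooth_map M N f \<longleftrightarrow>
     f \<in> points M \<rightarrow> points N \<and> (\<forall>p\<in>points M. smooth_at M N f p)"

definition real_line :: "real manifold" where
  "real_line = \<lparr> mdim = 1, mtop = euclideanreal, charts = {(UNIV, \<lambda>t i. if i = 0 then t else 0)} \<rparr>"

definition open_submanifold :: "'m manifold \<Rightarrow> 'm set \<Rightarrow> 'm manifold" where
  "open_submanifold M U =
     \<lparr> mdim = mdim M, mtop = subtopology (mtop M) U,
       charts = {(D \<inter> U, \<phi>) | D \<phi>. (D, \<phi>) \<in> charts M} \<rparr>"

text \<open>In products, the coordinates of the factors are concatenated.\<close>

definition prod_manifold :: "'m manifold \<Rightarrow> 'n manifold \<Rightarrow> ('m \<times> 'n) manifold" where
  "prod_manifold M N =
     \<lparr> mdim = mdim M + mdim N, mtop = prod_topology (mtop M) (mtop N),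
       charts = {(D \<times> E, \<lambda>(x, y) i. if i < mdim M then \<phi> x i else \<psi> y (i - mdim M)) | D \<phi> E \<psi>.
         (D, \<phi>) \<in> charts M \<and> (E, \<psi>) \<in> charts N} \<rparr>"

text \<open>The points of the \<open>r\<close>-fold power are the extensional families indexed by \<open>0, \<dots>, r - 1\<close>.\<close>

definition power_manifold :: "nat \<Rightarrow> 'm manifold \<Rightarrow> (nat \<Rightarrow> 'm) manifold" where
  "power_manifold r M =
     \<lparr> mdim = r * mdim M, mtop = product_topology (\<lambda>_. mtop M) {..<r},
       charts = {(PiE {..<r} D,
           \<lambda>x i. if i < r * mdim M then \<phi> (i div mdim M) (x (i div mdim M)) (i mod mdim M) else 0)
         | D \<phi>. \<forall>l<r. (D l, \<phi> l) \<in> charts M} \<rparr>"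


section \<open>Tangent vectors\<close>

text \<open>
  A tangent vector at \<open>p\<close> is a derivation of the algebra of real functions that are smooth in a
  neighbourhood of \<open>p\<close>. Its value on all other functions is fixed to be \<open>0\<close>, so that equal
  tangent vectors are equal functions. The vector space operations are the pointwise ones.
  A covector is a function on tangent vectors, and only its values on the relevant tangent space
  are significant.
\<close>

type_synonym 'm tvector = "('m \<Rightarrow> real) \<Rightarrow> real"
type_synonym 'm covector = "'m tvector \<Rightarrow> real"

definition tangent_space :: "'m manifold \<Rightarrow> 'm \<Rightarrow> 'm tvector set" where
  "tangent_space M p = {v.
     (\<forall>f. \<not> smooth_at M real_line f p \<longrightarrow> v f = 0) \<and>
     (\<forall>f h. smooth_at M real_line f p \<and> smooth_at M real_line h p \<longrightarrow>
        v (\<lambda>x. f x + h x) = v f + v h \<and>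
        v (\<lambda>x. f x * h x) = f p * v h + h p * v f) \<and>
     (\<forall>c f. smooth_at M real_line f p \<longrightarrow> v (\<lambda>x. c * f x) = c * v f)}"

abbreviation zero_tvector :: "'m tvector" where
  "zero_tvector \<equiv> (\<lambda>f. 0)"

definition tangent_map :: "'n manifold \<Rightarrow> ('m \<Rightarrow> 'n) \<Rightarrow> 'm \<Rightarrow> 'm tvector \<Rightarrow> 'n tvector" where
  "tangent_map N F p v =
     (\<lambda>f. if smooth_at N real_line f (F p) then v (\<lambda>x. f (F x)) else 0)"

definition velocity :: "'m manifold \<Rightarrow> (real \<Rightarrow> 'm) \<Rightarrow> 'm tvector" where
  "velocity M c = (\<lambda>f. if smooth_at M real_line f (c 0) then deriv (\<lambda>t. f (c t)) 0 else 0)"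

definition smooth_curve :: "'m manifold \<Rightarrow> (real \<Rightarrow> 'm) \<Rightarrow> 'm \<Rightarrow> 'm tvector \<Rightarrow> bool" where
  "smooth_curve M c p v \<longleftrightarrow> smooth_at real_line M c 0 \<and> c 0 = p \<and> velocity M c = v"


section \<open>Lie groups\<close>


definition lie_group :: "('g, 'x) monoid_scheme \<Rightarrow> 'g manifold \<Rightarrow> bool" where
  "lie_group G MG \<longleftrightarrow>
     group G \<and> smooth_manifold MG \<and> points MG = carrier G \<and>
     smooth_map (prod_manifold MG MG) MG (\<lambda>(g, h). g \<otimes>\<^bsub>G\<^esub> h) \<and>
     smooth_map MG MG (\<lambda>g. inv\<^bsub>G\<^esub> g)"

abbreviation lie_algebra :: "('g, 'x) monoid_scheme \<Rightarrow> 'g manifold \<Rightarrow> 'g tvector set" where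
  "lie_algebra G MG \<equiv> tangent_space MG \<one>\<^bsub>G\<^esub>"

text \<open>\<open>ltrans G MG g x v\<close> is \<open>g v\<close> and \<open>rtrans G MG x v h\<close> is \<open>v h\<close>, for \<open>v\<close> tangent at \<open>x\<close>.\<close>

definition ltrans ::
    "('g, 'x) monoid_scheme \<Rightarrow> 'g manifold \<Rightarrow> 'g \<Rightarrow> 'g \<Rightarrow> 'g tvector \<Rightarrow> 'g tvector" where
  "ltrans G MG g x v = tangent_map MG (\<lambda>y. g \<otimes>\<^bsub>G\<^esub> y) x v"

definition rtrans ::
    "('g, 'x) monoid_scheme \<Rightarrow> 'g manifold \<Rightarrow> 'g \<Rightarrow> 'g tvector \<Rightarrow> 'g \<Rightarrow> 'g tvector" where
  "rtrans G MG x v h = tangent_map MG (\<lambda>y. y \<otimes>\<^bsub>G\<^esub> h) x v"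

definition Ad :: "('g, 'x) monoid_scheme \<Rightarrow> 'g manifold \<Rightarrow> 'g \<Rightarrow> 'g tvector \<Rightarrow> 'g tvector" where
  "Ad G MG w \<eta> = tangent_map MG (\<lambda>y. w \<otimes>\<^bsub>G\<^esub> y \<otimes>\<^bsub>G\<^esub> inv\<^bsub>G\<^esub> w) \<one>\<^bsub>G\<^esub> \<eta>"

definition Ad_star :: "('g, 'x) monoid_scheme \<Rightarrow> 'g manifold \<Rightarrow> 'g \<Rightarrow> 'g covector \<Rightarrow> 'g covector" where
  "Ad_star G MG w \<mu> = (\<lambda>\<eta>. \<mu> (Ad G MG w \<eta>))"


section \<open>Principal bundles and discrete connections\<close>

definition local_trivialization ::
    "('g, 'x) monoid_scheme \<Rightarrow> 'g manifold \<Rightarrow> 'q manifold \<Rightarrow> ('g \<Rightarrow> 'q \<Rightarrow> 'q) \<Rightarrow>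
     'q set manifold \<Rightarrow> 'q set set \<Rightarrow> ('q set \<times> 'g \<Rightarrow> 'q) \<Rightarrow> bool" where
  "local_trivialization G MG MQ act MB U \<Phi> \<longleftrightarrow>
     openin (mtop MB) U \<and>
     (let Q\<^sub>U = {q \<in> points MQ. orbit G act q \<in> U};
          UG = prod_manifold (open_submanifold MB U) MG in
        bij_betw \<Phi> (U \<times> carrier G) Q\<^sub>U \<and>
        smooth_map UG (open_submanifold MQ Q\<^sub>U) \<Phi> \<and>
        smooth_map (open_submanifold MQ Q\<^sub>U) UG (inv_into (U \<times> carrier G) \<Phi>)) \<and>
     (\<forall>p\<in>U. \<forall>g\<in>carrier G.
        orbit G act (\<Phi> (p, g)) = p \<and>
        (\<forall>h\<in>carrier G. \<Phi> (p, h \<otimes>\<^bsub>G\<^esub> g) = act h (\<Phi> (p, g))))"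

text \<open>
  The base \<open>MB\<close> is \<open>Q/G\<close>: its points are the orbits and the projection is \<^const>\<open>orbit\<close>. Its
  topology and smooth structure are determined by the local trivializations.
\<close>

definition principal_bundle ::
    "('g, 'x) monoid_scheme \<Rightarrow> 'g manifold \<Rightarrow> 'q manifold \<Rightarrow> ('g \<Rightarrow> 'q \<Rightarrow> 'q) \<Rightarrow>
     'q set manifold \<Rightarrow> bool" where
  "principal_bundle G MG MQ act MB \<longleftrightarrow>
     lie_group G MG \<and> smooth_manifold MQ \<and> smooth_manifold MB \<and>
     group_action G (points MQ) act \<and>
     smooth_map (prod_manifold MG MQ) MQ (\<lambda>(g, q). act g q) \<and>
     (\<forall>g\<in>carrier G. \<forall>q\<in>points MQ. act g q = q \<longrightarrow> g = \<one>\<^bsub>G\<^esub>) \<and>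
     proper_map (prod_topology (mtop MG) (mtop MQ)) (prod_topology (mtop MQ) (mtop MQ))
       (\<lambda>(g, q). (act g q, q)) \<and>
     points MB = orbits G (points MQ) act \<and>
     smooth_map MQ MB (orbit G act) \<and>
     (\<forall>b\<in>points MB. \<exists>U \<Phi>. b \<in> U \<and> local_trivialization G MG MQ act MB U \<Phi>)"

definition discrete_connection ::
    "('g, 'x) monoid_scheme \<Rightarrow> 'q manifold \<Rightarrow> ('g \<Rightarrow> 'q \<Rightarrow> 'q) \<Rightarrow> ('q \<Rightarrow> 'q \<Rightarrow> 'g) \<Rightarrow> bool" where
  "discrete_connection G MQ act \<A> \<longleftrightarrow>
     (\<forall>q\<^sub>0\<in>points MQ. \<forall>q\<^sub>1\<in>points MQ. \<A> q\<^sub>0 q\<^sub>1 \<in> carrier G) \<and>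
     (\<forall>q\<^sub>0\<in>points MQ. \<forall>g\<in>carrier G. \<A> q\<^sub>0 (act g q\<^sub>0) = g) \<and>
     (\<forall>q\<^sub>0\<in>points MQ. \<forall>q\<^sub>1\<in>points MQ. \<forall>g\<in>carrier G. \<forall>h\<in>carrier G.
        \<A> (act g q\<^sub>0) (act h q\<^sub>1) = h \<otimes>\<^bsub>G\<^esub> \<A> q\<^sub>0 q\<^sub>1 \<otimes>\<^bsub>G\<^esub> inv\<^bsub>G\<^esub> g)"

definition local_connection ::
    "('g, 'x) monoid_scheme \<Rightarrow> ('b \<times> 'g \<Rightarrow> 'q) \<Rightarrow> ('q \<Rightarrow> 'q \<Rightarrow> 'g) \<Rightarrow> 'b \<Rightarrow> 'b \<Rightarrow> 'g" where
  "local_connection G \<Phi> \<A> p\<^sub>0 p\<^sub>1 = \<A> (\<Phi> (p\<^sub>0, \<one>\<^bsub>G\<^esub>)) (\<Phi> (p\<^sub>1, \<one>\<^bsub>G\<^esub>))"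


section \<open>The discrete variational problem\<close>

type_synonym ('b, 'g) dpoint = "(nat \<Rightarrow> 'b) \<times> (nat \<Rightarrow> 'g)"

text \<open>
  The domain \<open>U\<^sup>(\<^sup>k\<^sup>+\<^sup>1\<^sup>) \<times> G\<^sup>k\<close>. The families forming a point are indexed from \<open>0\<close>, whereas the
  \<open>2k + 1\<close> arguments are numbered from \<open>1\<close>: argument \<open>i\<close> with \<open>1 \<le> i \<le> k + 1\<close> is the entry
  \<open>i - 1\<close> of the first family, and argument \<open>z\<close> with \<open>k + 2 \<le> z \<le> 2k + 1\<close> is the entry
  \<open>z - (k + 2)\<close> of the second one.
\<close>

definition reduced_space :: "nat \<Rightarrow> 'b manifold \<Rightarrow> 'g manifold \<Rightarrow> ('b, 'g) dpoint manifold" where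
  "reduced_space k MU MG = prod_manifold (power_manifold (k + 1) MU) (power_manifold k MG)"

definition D_base :: "nat \<Rightarrow> (('b, 'g) dpoint \<Rightarrow> real) \<Rightarrow> ('b, 'g) dpoint \<Rightarrow> 'b covector" where
  "D_base i F a = (\<lambda>v. v (\<lambda>x. F ((fst a)(i - 1 := x), snd a)))"

definition D_group :: "nat \<Rightarrow> nat \<Rightarrow> (('b, 'g) dpoint \<Rightarrow> real) \<Rightarrow> ('b, 'g) dpoint \<Rightarrow> 'g covector" where
  "D_group k z F a = (\<lambda>w. w (\<lambda>x. F (fst a, (snd a)(z - (k + 2) := x))))"

definition window :: "nat \<Rightarrow> (nat \<Rightarrow> 'b) \<Rightarrow> (nat \<Rightarrow> 'g) \<Rightarrow> nat \<Rightarrow> ('b, 'g) dpoint" where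
  "window k p h n = ((\<lambda>j\<in>{..<k + 1}. p (n + j)), (\<lambda>j\<in>{..<k}. h (n + j)))"

definition action_sum ::
    "nat \<Rightarrow> nat \<Rightarrow> nat \<Rightarrow> (('b, 'g) dpoint \<Rightarrow> real) \<Rightarrow> (nat \<Rightarrow> ('b, 'g) dpoint \<Rightarrow> real) \<Rightarrow>
     (nat \<Rightarrow> 'b) \<Rightarrow> (nat \<Rightarrow> 'g) \<Rightarrow> (nat \<Rightarrow> nat \<Rightarrow> real) \<Rightarrow> real" where
  "action_sum k N m L chi p h lam =
     (\<Sum>n=0..N - k. L (window k p h n) + (\<Sum>\<alpha>=1..m. lam n \<alpha> * chi \<alpha> (window k p h n)))"

text \<open>
  The covectors \<open>T\<^sup>*L\<^sub>W\<^sub>A\<^sub>1(n)\<beta>\<close> and \<open>T\<^sup>*L\<^sub>W\<^sub>A\<^sub>2(n-1)\<beta>\<close> are \<open>\<beta>\<close> composed with the maps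
  \<open>\<delta>p \<mapsto> w\<langle>D\<^sub>1A(x, y), \<delta>p\<rangle>\<close> and \<open>\<delta>p \<mapsto> w\<langle>D\<^sub>2A(x, y), \<delta>p\<rangle>\<close> below.
\<close>

definition W_D1A ::
    "('g, 'x) monoid_scheme \<Rightarrow> 'g manifold \<Rightarrow> ('b \<Rightarrow> 'b \<Rightarrow> 'g) \<Rightarrow> 'g \<Rightarrow> 'b \<Rightarrow> 'b \<Rightarrow>
     'b tvector \<Rightarrow> 'g tvector" where
  "W_D1A G MG A w x y \<delta>p = ltrans G MG w (A x y) (tangent_map MG (\<lambda>x'. A x' y) x \<delta>p)"

definition W_D2A ::
    "('g, 'x) monoid_scheme \<Rightarrow> 'g manifold \<Rightarrow> ('b \<Rightarrow> 'b \<Rightarrow> 'g) \<Rightarrow> 'g \<Rightarrow> 'b \<Rightarrow> 'b \<Rightarrow>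
     'b tvector \<Rightarrow> 'g tvector" where
  "W_D2A G MG A w x y \<delta>p = ltrans G MG w (A x y) (tangent_map MG (\<lambda>y'. A x y') y \<delta>p)"

text \<open>
  \<open>-\<eta> w a + w \<eta>' a + w\<langle>D\<^sub>1A(x, y), \<delta>x\<rangle> + w\<langle>D\<^sub>2A(x, y), \<delta>y\<rangle>\<close> with \<open>a = A(x, y)\<close>.
\<close>

definition group_variation ::
    "('g, 'x) monoid_scheme \<Rightarrow> 'g manifold \<Rightarrow> ('b \<Rightarrow> 'b \<Rightarrow> 'g) \<Rightarrow> 'g \<Rightarrow> 'b \<Rightarrow> 'b \<Rightarrow>
     'g tvector \<Rightarrow> 'g tvector \<Rightarrow> 'b tvector \<Rightarrow> 'b tvector \<Rightarrow> 'g tvector" where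
  "group_variation G MG A w x y \<eta> \<eta>' \<delta>x \<delta>y =
     (\<lambda>f. - rtrans G MG \<one>\<^bsub>G\<^esub> \<eta> (w \<otimes>\<^bsub>G\<^esub> A x y) f
          + rtrans G MG w (ltrans G MG w \<one>\<^bsub>G\<^esub> \<eta>') (A x y) f
          + W_D1A G MG A w x y \<delta>x f
          + W_D2A G MG A w x y \<delta>y f)"

text \<open>
  \<open>\<delta>S = 0\<close>: the action sum has derivative zero along every smooth one-parameter family of
  sequences whose velocities are admissible variations. The multipliers vary freely.
\<close>

definition critical_sequence ::
    "('g, 'x) monoid_scheme \<Rightarrow> 'g manifold \<Rightarrow> 'b manifold \<Rightarrow> ('b \<Rightarrow> 'b \<Rightarrow> 'g) \<Rightarrow>
     nat \<Rightarrow> nat \<Rightarrow> nat \<Rightarrow> (('b, 'g) dpoint \<Rightarrow> real) \<Rightarrow> (nat \<Rightarrow> ('b, 'g) dpoint \<Rightarrow> real) \<Rightarrow>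
     (nat \<Rightarrow> 'b) \<Rightarrow> (nat \<Rightarrow> 'g) \<Rightarrow> (nat \<Rightarrow> nat \<Rightarrow> real) \<Rightarrow> bool" where
  "critical_sequence G MG MU A k N m L chi p g lam \<longleftrightarrow>
     (let W = (\<lambda>n. inv\<^bsub>G\<^esub> (g n) \<otimes>\<^bsub>G\<^esub> g (n + 1)) in
      \<forall>\<delta>p \<delta>g \<eta> P H \<Lambda>.
       (\<forall>i\<le>N. \<delta>p i \<in> tangent_space MU (p i) \<and> \<delta>g i \<in> tangent_space MG (g i) \<and>
               \<eta> i = ltrans G MG (inv\<^bsub>G\<^esub> (g i)) (g i) (\<delta>g i)) \<and>
       (\<forall>i\<le>N. i < k \<or> N - k < i \<longrightarrow> \<delta>p i = zero_tvector \<and> \<eta> i = zero_tvector) \<and>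
       (\<forall>i\<le>N. smooth_curve MU (P i) (p i) (\<delta>p i)) \<and>
       (\<forall>i<N. smooth_curve MG (H i) (W i \<otimes>\<^bsub>G\<^esub> A (p i) (p (i + 1)))
          (group_variation G MG A (W i) (p i) (p (i + 1))
             (\<eta> i) (\<eta> (i + 1)) (\<delta>p i) (\<delta>p (i + 1)))) \<and>
       (\<forall>n\<le>N - k. \<forall>\<alpha>\<in>{1..m}. smooth_at real_line real_line (\<Lambda> n \<alpha>) 0 \<and> \<Lambda> n \<alpha> 0 = lam n \<alpha>) \<longrightarrow>
       ((\<lambda>\<epsilon>. action_sum k N m L chi (\<lambda>i. P i \<epsilon>) (\<lambda>i. H i \<epsilon>) (\<lambda>n \<alpha>. \<Lambda> n \<alpha> \<epsilon>))
          has_real_derivative 0) (at 0))"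

end

theory Submission
  imports Defs
begin

text \<open>
  Along an admissible family of sequences, every summand of the action sum is a smooth function of
  \<open>2k + 1\<close> moving entries, so its derivative is the sum over the entries of the partial derivative
  applied to the velocity of that entry (\<open>derivative_along_curves\<close>). The multipliers move as well,
  but their velocities are multiplied by the constraint functions, which vanish on the sequence.
  The first variation is therefore that of \<open>\<L> + \<lambda>\<^sub>\<alpha>\<chi>\<^sup>\<alpha>\<close> with constant multipliers.

  What remains is a summation by parts. The variation of \<open>W\<^sub>jA\<^sub>j\<close> involves \<open>\<delta>p\<^sub>j\<close> and \<open>\<eta>\<^sub>j\<close> as well as
  \<open>\<delta>p\<^bsub>j+1\<^esub>\<close> and \<open>\<eta>\<^bsub>j+1\<^esub>\<close>. Collecting everything that multiplies the variations with a given index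
  \<open>n\<close> (\<open>sum_windows_by_entry\<close>; the terms near the ends vanish by the endpoint conditions) gives the
  horizontal equation applied to \<open>\<delta>p\<^sub>n\<close> plus the vertical equation applied to \<open>\<eta>\<^sub>n\<close>. For the latter,
  the term \<open>W\<^bsub>n-1\<^esub> \<eta>\<^sub>n A\<^bsub>n-1\<^esub>\<close> has to be recognized as the right translate of
  \<open>Ad \<eta>\<^sub>n\<close>, where \<open>Ad\<close> is taken at \<open>W\<^bsub>n-1\<^esub>\<close> (\<open>rtrans_Ad\<close>).

  Two general facts carry the differential calculus. A function with continuous partial derivatives
  on an open subset of \<open>\<real>\<^sup>n\<close> obeys the chain rule (\<open>chain_rule_along_curve\<close>, \<open>C_class_compose\<close>),
  which makes smooth maps between manifolds composable. Tangent vectors, being derivations on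
  functions defined everywhere, only see a function near their base point (\<open>tangent_vector_local\<close>),
  which allows group identities to be used inside them.
\<close>

section \<open>Differentiable functions on open subsets of Euclidean space\<close>

definition partial_derivatives ::
    "nat \<Rightarrow> (nat \<Rightarrow> real) set \<Rightarrow> ((nat \<Rightarrow> real) \<Rightarrow> real) \<Rightarrow> (nat \<Rightarrow> (nat \<Rightarrow> real) \<Rightarrow> real) \<Rightarrow> bool"
  where
  "partial_derivatives n S f f' \<longleftrightarrow>
     (\<forall>j<n. \<forall>x\<in>S. ((\<lambda>t. f (x(j := t))) has_real_derivative f' j x) (at (x j)))"

lemma partial_derivativesD:
  "partial_derivatives n S f f' \<Longrightarrow> j < n \<Longrightarrow> x \<in> S \<Longrightarrow>
     ((\<lambda>t. f (x(j := t))) has_real_derivative f' j x) (at (x j))"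
  by (simp add: partial_derivatives_def)

lemma C_class_Suc:
  "C_class n S (Suc r) f \<longleftrightarrow>
     continuous_map (subtopology (Euclidean_space n) S) euclideanreal f \<and>
     (\<exists>f'. partial_derivatives n S f f' \<and> (\<forall>j<n. C_class n S r (f' j)))"
  unfolding C_class.simps(2) partial_derivatives_def by (rule conj_cong[OF refl], rule ex_cong1) blast

declare C_class.simps(2) [simp del]

lemma C_class_SucI:
  "continuous_map (subtopology (Euclidean_space n) S) euclideanreal f \<Longrightarrow>
     partial_derivatives n S f f' \<Longrightarrow> (\<And>j. j < n \<Longrightarrow> C_class n S r (f' j)) \<Longrightarrow> C_class n S (Suc r) f"
  unfolding C_class_Suc by blast

lemma C_class_continuous:
  "C_class n S r f \<Longrightarrow> continuous_map (subtopology (Euclidean_space n) S) euclideanreal f"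
  by (cases r) (auto simp: C_class_Suc)

lemma C_class_Suc_imp: "C_class n S (Suc r) f \<Longrightarrow> C_class n S r f"
proof (induction r arbitrary: f)
  case 0
  then show ?case by (simp add: C_class_Suc)
next
  case (Suc r)
  obtain f' where f': "partial_derivatives n S f f'" "\<forall>j<n. C_class n S (Suc r) (f' j)"
    using Suc.prems unfolding C_class_Suc by blast
  with Suc.IH C_class_continuous[OF Suc.prems] show ?case
    by (blast intro: C_class_SucI)
qed

lemma C_class_subset: "C_class n S r f \<Longrightarrow> T \<subseteq> S \<Longrightarrow> C_class n T r f"
proof (induction r arbitrary: f)
  case 0
  then show ?case by (simp add: continuous_map_from_subtopology_mono)
next
  case (Suc r)
  obtain f' where f': "partial_derivatives n S f f'" "\<forall>j<n. C_class n S r (f' j)"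
    using Suc.prems(1) unfolding C_class_Suc by blast
  from f'(1) Suc.prems(2) have "partial_derivatives n T f f'"
    unfolding partial_derivatives_def by blast
  with f'(2) Suc.IH Suc.prems(2)
    continuous_map_from_subtopology_mono[OF C_class_continuous[OF Suc.prems(1)] Suc.prems(2)]
  show ?case
    by (blast intro: C_class_SucI)
qed

lemma Euclidean_update:
  "x \<in> topspace (Euclidean_space n) \<Longrightarrow> j < n \<Longrightarrow> x(j := t) \<in> topspace (Euclidean_space n)"
  by (simp add: topspace_Euclidean_space)

lemma openin_Euclidean_box:
  assumes S: "openin (Euclidean_space n) S" and x: "x \<in> S"
  obtains \<delta> where "\<delta> > 0"
    "\<And>y. y \<in> topspace (Euclidean_space n) \<Longrightarrow> (\<And>i. i < n \<Longrightarrow> \<bar>y i - x i\<bar> < \<delta>) \<Longrightarrow> y \<in> S"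
proof -
  obtain T where T: "openin (powertop_real UNIV) T" "S = T \<inter> {x. \<forall>i\<ge>n. x i = 0}"
    using S unfolding Euclidean_space_def openin_subtopology by blast
  then obtain B where B: "\<forall>i. open (B i)" "x \<in> PiE UNIV B" "PiE UNIV B \<subseteq> T"
    using x unfolding openin_product_topology_alt by (simp flip: open_openin) blast
  have "\<exists>d>0. \<forall>s. \<bar>s - x i\<bar> < d \<longrightarrow> s \<in> B i" for i
    using B(1,2) open_real unfolding open_dist by (auto simp: dist_real_def PiE_iff)
  then obtain d where d: "\<And>i. d i > 0" "\<And>i s. \<bar>s - x i\<bar> < d i \<Longrightarrow> s \<in> B i"
    by metis
  define \<delta> where "\<delta> = Min (insert 1 (d ` {..<n}))"
  have "\<delta> > 0" using d(1) by (simp add: \<delta>_def)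
  moreover have "y \<in> S"
    if y: "y \<in> topspace (Euclidean_space n)" "\<And>i. i < n \<Longrightarrow> \<bar>y i - x i\<bar> < \<delta>" for y
  proof -
    have "y i \<in> B i" for i
    proof (cases "i < n")
      case True
      then have "\<delta> \<le> d i" by (simp add: \<delta>_def)
      then show ?thesis using y(2)[OF True] d(2) by force
    next
      case False
      then have "y i = x i" using y(1) x T(2) by (auto simp: topspace_Euclidean_space)
      then show ?thesis using d by force
    qed
    then show "y \<in> S" using T(2) B(3) y(1) by (auto simp: topspace_Euclidean_space PiE_iff)
  qed
  ultimately show ?thesis using that by blast
qed

lemma eventually_update_in_open:
  assumes "openin (Euclidean_space n) S" "x \<in> S" "j < n"
  shows "eventually (\<lambda>t. x(j := t) \<in> S) (nhds (x j))"
proof -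
  obtain \<delta> where \<delta>: "\<delta> > 0"
    "\<And>y. y \<in> topspace (Euclidean_space n) \<Longrightarrow> (\<And>i. i < n \<Longrightarrow> \<bar>y i - x i\<bar> < \<delta>) \<Longrightarrow> y \<in> S"
    using openin_Euclidean_box[OF assms(1,2)] by blast
  have x: "x \<in> topspace (Euclidean_space n)" using assms(1,2) openin_subset by blast
  have "x(j := t) \<in> S" if "dist t (x j) < \<delta>" for t
    using that \<delta>(1) by (intro \<delta>(2) Euclidean_update[OF x assms(3)]) (auto simp: dist_real_def)
  then show ?thesis unfolding eventually_nhds_metric using \<delta>(1) by blast
qed

lemma C_class_cong:
  assumes S: "openin (Euclidean_space n) S"
  shows "C_class n S r f \<Longrightarrow> (\<And>x. x \<in> S \<Longrightarrow> f x = h x) \<Longrightarrow> C_class n S r h"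
proof (induction r arbitrary: f h)
  case 0
  from 0(1) have "continuous_map (subtopology (Euclidean_space n) S) euclideanreal f" by simp
  then have "continuous_map (subtopology (Euclidean_space n) S) euclideanreal h"
    by (rule continuous_map_eq) (simp add: 0(2))
  then show ?case by simp
next
  case (Suc r)
  obtain f' where f': "partial_derivatives n S f f'" "\<forall>j<n. C_class n S r (f' j)"
    using Suc.prems(1) unfolding C_class_Suc by blast
  have "partial_derivatives n S h f'"
    unfolding partial_derivatives_def
  proof (intro allI impI ballI)
    fix j x assume *: "j < n" "x \<in> S"
    have "eventually (\<lambda>t. f (x(j := t)) = h (x(j := t))) (nhds (x j))"
      using eventually_update_in_open[OF S *(2,1)] by eventually_elim (rule Suc.prems(2))
    from DERIV_cong_ev[OF refl this refl] partial_derivativesD[OF f'(1) *]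
    show "((\<lambda>t. h (x(j := t))) has_real_derivative f' j x) (at (x j))" by (rule iffD1)
  qed
  moreover have "continuous_map (subtopology (Euclidean_space n) S) euclideanreal h"
    by (rule continuous_map_eq[OF C_class_continuous[OF Suc.prems(1)]]) (simp add: Suc.prems(2))
  ultimately show ?case using f'(2) by (blast intro: C_class_SucI)
qed

lemma C_class_const: "C_class n S r (\<lambda>x. c)"
proof (induction r arbitrary: c)
  case (Suc r)
  then show ?case by (intro C_class_SucI[where f' = "\<lambda>j x. 0"]) (auto simp: partial_derivatives_def)
qed simp

lemma C_class_coordinate: "C_class n S r (\<lambda>x. x i)"
proof -
  have c: "continuous_map (subtopology (Euclidean_space n) S) euclideanreal (\<lambda>x. x i)"
    unfolding Euclidean_space_def
    by (intro continuous_map_from_subtopology continuous_map_product_projection) auto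
  show ?thesis
  proof (cases r)
    case (Suc r')
    have "partial_derivatives n S (\<lambda>x. x i) (\<lambda>j x. if i = j then 1 else 0)"
      by (auto simp: partial_derivatives_def)
    then show ?thesis
      unfolding Suc by (rule C_class_SucI[OF c]) (rule C_class_const)
  qed (use c in simp)
qed

lemma C_class_add: "C_class n S r f \<Longrightarrow> C_class n S r h \<Longrightarrow> C_class n S r (\<lambda>x. f x + h x)"
proof (induction r arbitrary: f h)
  case 0
  then show ?case by (simp add: continuous_map_add)
next
  case (Suc r)
  obtain f' where f': "partial_derivatives n S f f'" "\<forall>j<n. C_class n S r (f' j)"
    using Suc.prems(1) unfolding C_class_Suc by blast
  obtain h' where h': "partial_derivatives n S h h'" "\<forall>j<n. C_class n S r (h' j)"
    using Suc.prems(2) unfolding C_class_Suc by blast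
  have "partial_derivatives n S (\<lambda>x. f x + h x) (\<lambda>j x. f' j x + h' j x)"
    using partial_derivativesD[OF f'(1)] partial_derivativesD[OF h'(1)]
    by (auto simp: partial_derivatives_def intro!: DERIV_add simp del: fun_upd_apply)
  moreover have "continuous_map (subtopology (Euclidean_space n) S) euclideanreal (\<lambda>x. f x + h x)"
    using Suc.prems by (intro continuous_map_add C_class_continuous)
  ultimately show ?case
    using f'(2) h'(2) Suc.IH by (blast intro: C_class_SucI)
qed

lemma C_class_mult: "C_class n S r f \<Longrightarrow> C_class n S r h \<Longrightarrow> C_class n S r (\<lambda>x. f x * h x)"
proof (induction r arbitrary: f h)
  case 0
  then show ?case by (simp add: continuous_map_real_mult)
next
  case (Suc r)
  obtain f' where f': "partial_derivatives n S f f'" "\<forall>j<n. C_class n S r (f' j)"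
    using Suc.prems(1) unfolding C_class_Suc by blast
  obtain h' where h': "partial_derivatives n S h h'" "\<forall>j<n. C_class n S r (h' j)"
    using Suc.prems(2) unfolding C_class_Suc by blast
  have "C_class n S r (\<lambda>x. f' j x * h x + h' j x * f x)" if "j < n" for j
    using that f'(2) h'(2) Suc.prems[THEN C_class_Suc_imp] by (auto intro!: C_class_add Suc.IH)
  moreover have "partial_derivatives n S (\<lambda>x. f x * h x) (\<lambda>j x. f' j x * h x + h' j x * f x)"
    unfolding partial_derivatives_def
  proof (intro allI impI ballI)
    fix j x assume *: "j < n" "x \<in> S"
    show "((\<lambda>t. f (x(j := t)) * h (x(j := t))) has_real_derivative
        f' j x * h x + h' j x * f x) (at (x j))"
      using DERIV_mult[OF partial_derivativesD[OF f'(1) *] partial_derivativesD[OF h'(1) *]] by simp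
  qed
  moreover have "continuous_map (subtopology (Euclidean_space n) S) euclideanreal (\<lambda>x. f x * h x)"
    using Suc.prems by (intro continuous_map_real_mult C_class_continuous)
  ultimately show ?case
    by (blast intro: C_class_SucI)
qed

lemma C_class_sum:
  "(\<And>i. i \<in> I \<Longrightarrow> C_class n S r (F i)) \<Longrightarrow> C_class n S r (\<lambda>x. \<Sum>i\<in>I. F i x)"
  by (induction I rule: infinite_finite_induct) (auto intro: C_class_const C_class_add)

text \<open>
  Continuous partial derivatives imply total differentiability, because \<open>x\<close> is changed into \<open>y\<close> one
  coordinate after the other, and the mean value inequality is applied to each change.
\<close>

lemma linear_approximation_of_continuous_partials:
  fixes f :: "(nat \<Rightarrow> real) \<Rightarrow> real"
  assumes S: "openin (Euclidean_space n) S" and x: "x \<in> S" and e: "e > 0"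
    and f': "partial_derivatives n S f f'"
    and cont: "\<And>j. j < n \<Longrightarrow> continuous_map (subtopology (Euclidean_space n) S) euclideanreal (f' j)"
  obtains \<delta> where "\<delta> > 0"
    "\<And>y. y \<in> topspace (Euclidean_space n) \<Longrightarrow> (\<And>i. i < n \<Longrightarrow> \<bar>y i - x i\<bar> < \<delta>) \<Longrightarrow>
       \<bar>f y - f x - (\<Sum>j<n. f' j x * (y j - x j))\<bar> \<le> e * (\<Sum>j<n. \<bar>y j - x j\<bar>)"
proof -
  define T where "T = S \<inter> (\<Inter>j\<in>{..<n}. {y \<in> S. f' j y \<in> {f' j x - e<..<f' j x + e}})"
  have xtop: "x \<in> topspace (Euclidean_space n)" using S x openin_subset by blast
  have "openin (Euclidean_space n) {y \<in> S. f' j y \<in> {f' j x - e<..<f' j x + e}}" if "j < n" for j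
  proof -
    have "openin (subtopology (Euclidean_space n) S)
        {y \<in> topspace (subtopology (Euclidean_space n) S). f' j y \<in> {f' j x - e<..<f' j x + e}}"
      by (rule openin_continuous_map_preimage[OF cont[OF that]]) (simp flip: open_openin)
    also have "topspace (subtopology (Euclidean_space n) S) = S"
      using openin_subset[OF S] by auto
    finally show ?thesis using S openin_trans_full by blast
  qed
  then have T: "openin (Euclidean_space n) T"
    unfolding T_def using S by (cases "n = 0") (auto intro!: openin_Int openin_INT2)
  have "x \<in> T" using x e by (auto simp: T_def)
  from openin_Euclidean_box[OF T this] obtain \<delta> where \<delta>: "\<delta> > 0"
    "\<And>y. y \<in> topspace (Euclidean_space n) \<Longrightarrow> (\<And>i. i < n \<Longrightarrow> \<bar>y i - x i\<bar> < \<delta>) \<Longrightarrow> y \<in> T"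
    by blast
  have "\<bar>f y - f x - (\<Sum>j<n. f' j x * (y j - x j))\<bar> \<le> e * (\<Sum>j<n. \<bar>y j - x j\<bar>)"
    if y: "y \<in> topspace (Euclidean_space n)" "\<And>i. i < n \<Longrightarrow> \<bar>y i - x i\<bar> < \<delta>" for y
  proof -
    (* The path from x to y: z i has the first i coordinates of y and the others of x. *)
    define z where "z i = (\<lambda>l. if l < i then y l else x l)" for i
    have z_Suc: "z (Suc i) = (z i)(i := y i)" and z_i: "(z i)(i := x i) = z i" for i
      by (auto simp: z_def less_Suc_eq)
    have z0: "z 0 = x" by (auto simp: z_def)
    have zn: "z n = y" using xtop y(1) by (auto simp: z_def topspace_Euclidean_space)
    have step: "\<bar>f (z (Suc i)) - f (z i) - f' i x * (y i - x i)\<bar> \<le> e * \<bar>y i - x i\<bar>"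
      if i: "i < n" for i
    proof -
      let ?\<phi> = "\<lambda>s. f ((z i)(i := s)) - f' i x * s"
      have inT: "(z i)(i := s) \<in> T" if "s \<in> ball (x i) \<delta>" for s
        using xtop y \<delta>(1) that i
        by (intro \<delta>(2)) (auto simp: z_def topspace_Euclidean_space dist_real_def)
      have "norm (?\<phi> (y i) - ?\<phi> (x i)) \<le> e * norm (y i - x i)"
      proof (rule field_differentiable_bound[where S = "ball (x i) \<delta>"
            and f' = "\<lambda>s. f' i ((z i)(i := s)) - f' i x"])
        fix s assume s: "s \<in> ball (x i) \<delta>"
        have "((\<lambda>t. f (((z i)(i := s))(i := t))) has_real_derivative f' i ((z i)(i := s)))
            (at (((z i)(i := s)) i))"
          using inT[OF s] by (intro partial_derivativesD[OF f' i]) (auto simp: T_def)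
        then have "((\<lambda>t. f ((z i)(i := t))) has_real_derivative f' i ((z i)(i := s))) (at s)"
          by simp
        then show "(?\<phi> has_real_derivative f' i ((z i)(i := s)) - f' i x) (at s within ball (x i) \<delta>)"
          by (intro has_field_derivative_at_within[OF DERIV_diff[OF _ DERIV_cmult_Id]])
        have "f' i ((z i)(i := s)) \<in> {f' i x - e<..<f' i x + e}"
          using inT[OF s] i unfolding T_def by blast
        then show "norm (f' i ((z i)(i := s)) - f' i x) \<le> e" by auto
      qed (use y(2)[OF i] \<delta>(1) in \<open>auto simp: dist_real_def abs_minus_commute\<close>)
      then show ?thesis unfolding z_Suc by (simp add: z_i algebra_simps)
    qed
    have "f y - f x = (\<Sum>i<n. f (z (Suc i)) - f (z i))"
      using sum_lessThan_telescope[of "\<lambda>i. f (z i)" n] by (simp add: z0 zn)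
    then have "\<bar>f y - f x - (\<Sum>j<n. f' j x * (y j - x j))\<bar> =
        \<bar>\<Sum>i<n. f (z (Suc i)) - f (z i) - f' i x * (y i - x i)\<bar>"
      by (simp add: sum_subtractf)
    also have "\<dots> \<le> (\<Sum>i<n. e * \<bar>y i - x i\<bar>)"
      using step by (intro order_trans[OF sum_abs] sum_mono) auto
    finally show ?thesis by (simp add: sum_distrib_left)
  qed
  with \<delta>(1) show ?thesis using that by blast
qed

lemma chain_rule_along_curve:
  fixes f :: "(nat \<Rightarrow> real) \<Rightarrow> real" and c :: "real \<Rightarrow> nat \<Rightarrow> real"
  assumes S: "openin (Euclidean_space n) S" and cS: "c s \<in> S"
    and f': "partial_derivatives n S f f'"
    and cont: "\<And>j. j < n \<Longrightarrow> continuous_map (subtopology (Euclidean_space n) S) euclideanreal (f' j)"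
    and ctop: "eventually (\<lambda>t. c t \<in> topspace (Euclidean_space n)) (at s)"
    and c': "\<And>j. j < n \<Longrightarrow> ((\<lambda>t. c t j) has_real_derivative d j) (at s)"
  shows "((\<lambda>t. f (c t)) has_real_derivative (\<Sum>j<n. f' j (c s) * d j)) (at s)"
proof -
  define q where "q j h = (c (s + h) j - c s j) / h" for j h
  (* The error of the linear approximation divided by h; differentiability says that it tends to 0. *)
  define R where "R h = (f (c (s + h)) - f (c s)) / h - (\<Sum>j<n. f' j (c s) * q j h)" for h
  have q: "(q j \<longlongrightarrow> d j) (at 0)" if "j < n" for j
    using c'[OF that] unfolding DERIV_def q_def .
  have ctop': "eventually (\<lambda>h. c (s + h) \<in> topspace (Euclidean_space n)) (at 0)"
    using ctop eventually_at_to_0[of _ s] by (simp add: add.commute)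
  have near: "eventually (\<lambda>h. \<bar>c (s + h) j - c s j\<bar> < \<delta>) (at 0)" if "j < n" "\<delta> > 0" for j \<delta>
  proof -
    have "((\<lambda>h. c (s + h) j) \<longlongrightarrow> c s j) (at 0)"
      using DERIV_isCont[OF c'[OF that(1)]] by (simp add: isCont_iff)
    then show ?thesis using that(2) by (auto simp: tendsto_iff dist_real_def)
  qed
  have "(R \<longlongrightarrow> 0) (at 0)"
  proof (rule tendstoI)
    fix e :: real assume e: "e > 0"
    (* K eventually bounds the sum of the difference quotients, so a slope error of e / K suffices. *)
    define K where "K = (\<Sum>j<n. \<bar>d j\<bar>) + 1"
    have K: "K > 0" using sum_nonneg[of "{..<n}" "\<lambda>j. \<bar>d j\<bar>"] by (simp add: K_def add_nonneg_pos)
    have eK: "e / K > 0" using e K by simp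
    obtain \<delta> where \<delta>: "\<delta> > 0"
      "\<And>y. y \<in> topspace (Euclidean_space n) \<Longrightarrow> (\<And>i. i < n \<Longrightarrow> \<bar>y i - c s i\<bar> < \<delta>) \<Longrightarrow>
        \<bar>f y - f (c s) - (\<Sum>j<n. f' j (c s) * (y j - c s j))\<bar> \<le> e / K * (\<Sum>j<n. \<bar>y j - c s j\<bar>)"
      using linear_approximation_of_continuous_partials[OF S cS eK f' cont] by blast
    have "((\<lambda>h. \<Sum>j<n. \<bar>q j h\<bar>) \<longlongrightarrow> (\<Sum>j<n. \<bar>d j\<bar>)) (at 0)"
      using q by (intro tendsto_sum tendsto_rabs) auto
    then have "eventually (\<lambda>h. (\<Sum>j<n. \<bar>q j h\<bar>) < K) (at 0)"
      by (rule order_tendstoD) (simp add: K_def)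
    moreover have "eventually (\<lambda>h. \<forall>j\<in>{..<n}. \<bar>c (s + h) j - c s j\<bar> < \<delta>) (at 0)"
      using near \<delta>(1) by (intro eventually_ball_finite) auto
    moreover have "eventually (\<lambda>h::real. h \<noteq> 0) (at 0)" by (simp add: eventually_at_filter)
    ultimately show "eventually (\<lambda>h. dist (R h) 0 < e) (at 0)"
      using ctop'
    proof eventually_elim
      case (elim h)
      have "\<bar>R h\<bar> * \<bar>h\<bar> = \<bar>f (c (s + h)) - f (c s) - (\<Sum>j<n. f' j (c s) * (c (s + h) j - c s j))\<bar>"
        using elim(3) unfolding R_def q_def abs_mult[symmetric] left_diff_distrib sum_distrib_right
        by simp
      also have "\<dots> \<le> e / K * (\<Sum>j<n. \<bar>c (s + h) j - c s j\<bar>)"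
        using elim by (intro \<delta>(2)) auto
      also have "\<dots> = e / K * (\<Sum>j<n. \<bar>q j h\<bar>) * \<bar>h\<bar>"
        using elim(3) by (simp add: q_def sum_distrib_right abs_divide)
      finally have "\<bar>R h\<bar> \<le> e / K * (\<Sum>j<n. \<bar>q j h\<bar>)"
        by (rule mult_right_le_imp_le) (use elim(3) in simp)
      also have "\<dots> < e / K * K" using elim(1) e K by (intro mult_strict_left_mono) auto
      finally show ?case using K by simp
    qed
  qed
  then have "((\<lambda>h. R h + (\<Sum>j<n. f' j (c s) * q j h)) \<longlongrightarrow> 0 + (\<Sum>j<n. f' j (c s) * d j)) (at 0)"
    using q by (intro tendsto_intros) auto
  then show ?thesis by (simp add: DERIV_def R_def)
qed

lemma continuous_map_into_Euclidean:
  assumes "\<And>i. i < m \<Longrightarrow> continuous_map X euclideanreal (\<lambda>x. g x i)"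
    and "\<And>x. x \<in> topspace X \<Longrightarrow> g x \<in> topspace (Euclidean_space m)"
  shows "continuous_map X (Euclidean_space m) g"
proof -
  have "continuous_map X (Euclidean_space m) (\<lambda>x i. if i < m then g x i else 0)"
    using assms(1) by (simp add: continuous_map_componentwise_Euclidean_space)
  then show ?thesis
    by (rule continuous_map_eq) (use assms(2) in \<open>auto simp: topspace_Euclidean_space\<close>)
qed

text \<open>
  The partial derivatives of a composition are sums of products of compositions of the same shape
  with one order of differentiability less, so that induction applies.
\<close>

lemma C_class_compose:
  assumes S: "openin (Euclidean_space n) S" and T: "openin (Euclidean_space m) T"
    and gT: "g ` S \<subseteq> T"
  shows "C_class m T r f \<Longrightarrow> (\<And>i. i < m \<Longrightarrow> C_class n S r (\<lambda>x. g x i)) \<Longrightarrow> C_class n S r (\<lambda>x. f (g x))"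
proof (induction r arbitrary: f)
  have ctop: "topspace (subtopology (Euclidean_space n) S) = S"
    using openin_subset[OF S] by auto
  have gtop: "g x \<in> topspace (Euclidean_space m)" if "x \<in> S" for x
    using that gT openin_subset[OF T] by auto
  have cont: "continuous_map (subtopology (Euclidean_space n) S) euclideanreal (\<lambda>x. f (g x))"
    if "C_class m T r f" "\<And>i. i < m \<Longrightarrow> C_class n S r (\<lambda>x. g x i)" for f r
  proof -
    have "continuous_map (subtopology (Euclidean_space n) S) (Euclidean_space m) g"
      by (rule continuous_map_into_Euclidean[OF C_class_continuous[OF that(2)]])
        (simp_all add: gtop ctop)
    then have "continuous_map (subtopology (Euclidean_space n) S) (subtopology (Euclidean_space m) T) g"
      using gT ctop by (auto simp: continuous_map_in_subtopology)
    from continuous_map_compose[OF this C_class_continuous[OF that(1)]] show ?thesis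
      by (simp add: o_def)
  qed
  {
    case 0
    then show ?case using cont[of 0 f] by simp
  next
    case (Suc r)
    obtain f' where f': "partial_derivatives m T f f'" "\<forall>j<m. C_class m T r (f' j)"
      using Suc.prems(1) unfolding C_class_Suc by blast
    have "\<forall>i. \<exists>g'. i < m \<longrightarrow>
        partial_derivatives n S (\<lambda>x. g x i) g' \<and> (\<forall>j<n. C_class n S r (g' j))"
      using Suc.prems(2) unfolding C_class_Suc by blast
    from choice[OF this] obtain g' where
      g': "\<And>i. i < m \<Longrightarrow> partial_derivatives n S (\<lambda>x. g x i) (g' i)"
        "\<And>i j. i < m \<Longrightarrow> j < n \<Longrightarrow> C_class n S r (g' i j)"
      by blast
    have "partial_derivatives n S (\<lambda>x. f (g x)) (\<lambda>j x. \<Sum>i<m. f' i (g x) * g' i j x)"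
      unfolding partial_derivatives_def
    proof (intro allI impI ballI)
      fix j x assume j: "j < n" and x: "x \<in> S"
      have "((\<lambda>t. f (g (x(j := t)))) has_real_derivative
          (\<Sum>i<m. f' i (g (x(j := x j))) * g' i j x)) (at (x j))"
      proof (rule chain_rule_along_curve[OF T, where c = "\<lambda>t. g (x(j := t))"])
        show "g (x(j := x j)) \<in> T" using x gT by auto
        have "eventually (\<lambda>t. x(j := t) \<in> S) (at (x j))"
          using eventually_update_in_open[OF S x j] eventually_at_filter eventually_mono by fastforce
        then show "eventually (\<lambda>t. g (x(j := t)) \<in> topspace (Euclidean_space m)) (at (x j))"
          by eventually_elim (rule gtop)
      qed (use f' C_class_continuous partial_derivativesD[OF g'(1) j x] in auto)
      then show "((\<lambda>t. f (g (x(j := t)))) has_real_derivative (\<Sum>i<m. f' i (g x) * g' i j x))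
        (at (x j))" by simp
    qed
    moreover have "C_class n S r (\<lambda>x. \<Sum>i<m. f' i (g x) * g' i j x)" if j: "j < n" for j
      using Suc.IH f'(2) g'(2) j Suc.prems(2)[THEN C_class_Suc_imp]
      by (intro C_class_sum C_class_mult) auto
    ultimately show ?case
      using cont[OF Suc.prems] by (blast intro: C_class_SucI)
  }
qed

lemma C_infinity_subset: "C_infinity n S f \<Longrightarrow> T \<subseteq> S \<Longrightarrow> C_infinity n T f"
  unfolding C_infinity_def using C_class_subset by blast

lemma C_infinity_cong:
  "openin (Euclidean_space n) S \<Longrightarrow> C_infinity n S f \<Longrightarrow> (\<And>x. x \<in> S \<Longrightarrow> f x = h x) \<Longrightarrow> C_infinity n S h"
  unfolding C_infinity_def using C_class_cong by blast

lemma C_infinity_const: "C_infinity n S (\<lambda>x. c)"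
  by (simp add: C_infinity_def C_class_const)

lemma C_infinity_coordinate: "C_infinity n S (\<lambda>x. x i)"
  by (simp add: C_infinity_def C_class_coordinate)

lemma C_infinity_add: "C_infinity n S f \<Longrightarrow> C_infinity n S h \<Longrightarrow> C_infinity n S (\<lambda>x. f x + h x)"
  by (simp add: C_infinity_def C_class_add)

lemma C_infinity_mult: "C_infinity n S f \<Longrightarrow> C_infinity n S h \<Longrightarrow> C_infinity n S (\<lambda>x. f x * h x)"
  by (simp add: C_infinity_def C_class_mult)

lemma C_infinity_continuous:
  "C_infinity n S f \<Longrightarrow> continuous_map (subtopology (Euclidean_space n) S) euclideanreal f"
  unfolding C_infinity_def using C_class_continuous by blast

lemma C_infinity_compose:
  assumes "openin (Euclidean_space n) S" "openin (Euclidean_space m) T" "g ` S \<subseteq> T"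
    and "C_infinity m T f" "\<And>i. i < m \<Longrightarrow> C_infinity n S (\<lambda>x. g x i)"
  shows "C_infinity n S (\<lambda>x. f (g x))"
  using assms(4,5) unfolding C_infinity_def by (blast intro: C_class_compose[OF assms(1,2,3)])

section \<open>Charts and smoothness in charts\<close>

definition is_chart :: "nat \<Rightarrow> 'm topology \<Rightarrow> 'm set \<Rightarrow> ('m \<Rightarrow> nat \<Rightarrow> real) \<Rightarrow> bool" where
  "is_chart n X D \<phi> \<longleftrightarrow>
     openin X D \<and> openin (Euclidean_space n) (\<phi> ` D) \<and>
     homeomorphic_map (subtopology X D) (subtopology (Euclidean_space n) (\<phi> ` D)) \<phi>"

lemma topspace_subtopology_openin: "openin X D \<Longrightarrow> topspace (subtopology X D) = D"
  using openin_subset by auto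

lemma is_chart_inj: "is_chart n X D \<phi> \<Longrightarrow> inj_on \<phi> D"
  unfolding is_chart_def
  using homeomorphic_imp_injective_map topspace_subtopology_openin by metis

lemma is_chart_open_image:
  assumes "is_chart n X D \<phi>" "V \<subseteq> D"
  shows "openin (Euclidean_space n) (\<phi> ` V) \<longleftrightarrow> openin X V"
proof -
  have "openin (subtopology (Euclidean_space n) (\<phi> ` D)) (\<phi> ` V) \<longleftrightarrow> openin (subtopology X D) V"
    using assms topspace_subtopology_openin[of X D]
    by (intro homeomorphic_map_openness) (auto simp only: is_chart_def)
  then show ?thesis using assms by (auto simp: is_chart_def openin_open_subtopology)
qed

lemma is_chart_in_Euclidean:
  "is_chart n X D \<phi> \<Longrightarrow> x \<in> D \<Longrightarrow> \<phi> x \<in> topspace (Euclidean_space n)"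
  unfolding is_chart_def using openin_subset by blast

lemma is_chart_continuous_coordinate:
  assumes "is_chart n X D \<phi>"
  shows "continuous_map (subtopology X D) euclideanreal (\<lambda>x. \<phi> x i)"
proof -
  have "continuous_map (subtopology X D) (Euclidean_space n) \<phi>"
    using assms homeomorphic_imp_continuous_map continuous_map_in_subtopology
    unfolding is_chart_def by blast
  then have "continuous_map (subtopology X D) (powertop_real UNIV) \<phi>"
    unfolding Euclidean_space_def continuous_map_in_subtopology by blast
  then show ?thesis by (simp add: continuous_map_componentwise_UNIV)
qed

lemma is_chart_inverse:
  assumes "is_chart n X D \<phi>"
  obtains g where "continuous_map (subtopology (Euclidean_space n) (\<phi> ` D)) X g" "\<forall>x\<in>D. g (\<phi> x) = x"
proof -
  obtain g where "homeomorphic_maps (subtopology X D) (subtopology (Euclidean_space n) (\<phi> ` D)) \<phi> g"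
    using assms unfolding is_chart_def homeomorphic_map_maps by blast
  then show ?thesis
    using that assms topspace_subtopology_openin[of X D]
    unfolding homeomorphic_maps_def is_chart_def continuous_map_in_subtopology by auto
qed

lemma is_chartI:
  assumes D: "openin X D" and img: "openin (Euclidean_space n) (\<phi> ` D)"
    and cont: "\<And>i. i < n \<Longrightarrow> continuous_map (subtopology X D) euclideanreal (\<lambda>x. \<phi> x i)"
    and g: "continuous_map (subtopology (Euclidean_space n) (\<phi> ` D)) X g" "\<And>x. x \<in> D \<Longrightarrow> g (\<phi> x) = x"
  shows "is_chart n X D \<phi>"
proof -
  have D': "topspace (subtopology X D) = D"
    and img': "topspace (subtopology (Euclidean_space n) (\<phi> ` D)) = \<phi> ` D"
    by (rule topspace_subtopology_openin[OF D], rule topspace_subtopology_openin[OF img])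
  have "\<phi> x \<in> topspace (Euclidean_space n)" if "x \<in> D" for x
    using openin_subset[OF img] that by blast
  then have "continuous_map (subtopology X D) (Euclidean_space n) \<phi>"
    by (intro continuous_map_into_Euclidean cont) (simp_all only: D')
  then have "homeomorphic_maps (subtopology X D) (subtopology (Euclidean_space n) (\<phi> ` D)) \<phi> g"
    using g D' img' unfolding homeomorphic_maps_def continuous_map_in_subtopology by auto
  then show ?thesis
    unfolding is_chart_def homeomorphic_map_maps using D img by blast
qed

text \<open>
  The predicate \<^const>\<open>smooth_at\<close> lets the charts be chosen freely; here they are parameters, so that
  compositions can be formed by matching the chart in the middle.
\<close>

definition smooth_in :: "nat \<Rightarrow> 'm topology \<Rightarrow> 'm set \<Rightarrow> ('m \<Rightarrow> nat \<Rightarrow> real) \<Rightarrow>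
    nat \<Rightarrow> 'n set \<Rightarrow> ('n \<Rightarrow> nat \<Rightarrow> real) \<Rightarrow> ('m \<Rightarrow> 'n) \<Rightarrow> 'm \<Rightarrow> bool" where
  "smooth_in m X D \<phi> n E \<psi> f p \<longleftrightarrow>
     (\<exists>V. openin X V \<and> p \<in> V \<and> V \<subseteq> D \<and> f ` V \<subseteq> E \<and>
        (\<forall>j<n. C_infinity m (\<phi> ` V) (\<lambda>x. \<psi> (f (inv_into D \<phi> x)) j)))"

lemma smooth_at_iff_smooth_in:
  "smooth_at M N f p \<longleftrightarrow>
     (\<exists>(D, \<phi>)\<in>charts M. \<exists>(E, \<psi>)\<in>charts N.
        smooth_in (mdim M) (mtop M) D \<phi> (mdim N) E \<psi> f p)"
  unfolding smooth_at_def smooth_in_def by (rule refl)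

text \<open>
  The preimage under \<open>f\<close> of the domain of \<open>h\<close> has to be open. The continuity of \<open>f\<close> that this takes
  comes from its coordinate functions.
\<close>

lemma smooth_in_compose:
  assumes D: "is_chart m X D \<phi>" and E: "is_chart n Y E \<psi>"
    and f: "smooth_in m X D \<phi> n E \<psi> f p" and h: "smooth_in n Y E \<psi> l E' \<psi>' h (f p)"
  shows "smooth_in m X D \<phi> l E' \<psi>' (\<lambda>x. h (f x)) p"
proof -
  from f obtain V where V: "openin X V" "p \<in> V" "V \<subseteq> D" "f ` V \<subseteq> E"
    and fC: "\<And>j. j < n \<Longrightarrow> C_infinity m (\<phi> ` V) (\<lambda>x. \<psi> (f (inv_into D \<phi> x)) j)"
    unfolding smooth_in_def by blast
  from h obtain V' where V': "openin Y V'" "f p \<in> V'" "V' \<subseteq> E" "h ` V' \<subseteq> E'"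
    and hC: "\<And>j. j < l \<Longrightarrow> C_infinity n (\<psi> ` V') (\<lambda>x. \<psi>' (h (inv_into E \<psi> x)) j)"
    unfolding smooth_in_def by blast
  define G where "G x = \<psi> (f (inv_into D \<phi> x))" for x
  define W where "W = {x \<in> V. f x \<in> V'}"
  have inv: "inv_into D \<phi> (\<phi> x) = x" if "x \<in> D" for x
    using is_chart_inj[OF D] that by simp
  have inv': "inv_into E \<psi> (\<psi> x) = x" if "x \<in> E" for x
    using is_chart_inj[OF E] that by simp
  have oV: "openin (Euclidean_space m) (\<phi> ` V)"
    using is_chart_open_image[OF D V(3)] V(1) by simp
  have oV': "openin (Euclidean_space n) (\<psi> ` V')"
    using is_chart_open_image[OF E V'(3)] V'(1) by simp
  have G: "G (\<phi> x) = \<psi> (f x)" if "x \<in> V" for x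
    using that V(3) inv by (auto simp: G_def)
  have "continuous_map (subtopology (Euclidean_space m) (\<phi> ` V)) (Euclidean_space n) G"
  proof (rule continuous_map_into_Euclidean)
    show "continuous_map (subtopology (Euclidean_space m) (\<phi> ` V)) euclideanreal (\<lambda>x. G x i)"
      if "i < n" for i
      using C_infinity_continuous[OF fC[OF that]] by (simp add: G_def)
    show "G y \<in> topspace (Euclidean_space n)"
      if y: "y \<in> topspace (subtopology (Euclidean_space m) (\<phi> ` V))" for y
    proof -
      obtain x where "x \<in> V" "y = \<phi> x"
        using y topspace_subtopology_openin[OF oV] by blast
      then show ?thesis using G V(4) is_chart_in_Euclidean[OF E] by auto
    qed
  qed
  from openin_continuous_map_preimage[OF this oV']
  have "openin (subtopology (Euclidean_space m) (\<phi> ` V)) {y \<in> \<phi> ` V. G y \<in> \<psi> ` V'}"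
    unfolding topspace_subtopology_openin[OF oV] .
  moreover have "{y \<in> \<phi> ` V. G y \<in> \<psi> ` V'} = \<phi> ` W"
  proof -
    have "G (\<phi> x) \<in> \<psi> ` V' \<longleftrightarrow> f x \<in> V'" if "x \<in> V" for x
      using that V(4) V'(3) by (simp add: G inj_on_image_mem_iff[OF is_chart_inj[OF E]] image_subset_iff)
    then show ?thesis unfolding W_def by auto
  qed
  ultimately have "openin (subtopology (Euclidean_space m) (\<phi> ` V)) (\<phi> ` W)" by simp
  then have oW: "openin (Euclidean_space m) (\<phi> ` W)"
    by (rule openin_trans_full[OF _ oV])
  have WD: "W \<subseteq> D" using V(3) by (auto simp: W_def)
  have "C_infinity m (\<phi> ` W) (\<lambda>x. \<psi>' (h (f (inv_into D \<phi> x))) j)" if "j < l" for j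
  proof -
    have "C_infinity m (\<phi> ` W) (\<lambda>x. \<psi>' (h (inv_into E \<psi> (G x))) j)"
    proof (rule C_infinity_compose[OF oW oV' _ hC[OF that]])
      show "G ` \<phi> ` W \<subseteq> \<psi> ` V'" using G by (auto simp: W_def)
      show "C_infinity m (\<phi> ` W) (\<lambda>x. G x i)" if "i < n" for i
        unfolding G_def by (rule C_infinity_subset[OF fC[OF that]]) (auto simp: W_def)
    qed
    then show ?thesis
    proof (rule C_infinity_cong[OF oW])
      fix y assume "y \<in> \<phi> ` W"
      then obtain x where x: "x \<in> W" "y = \<phi> x" by blast
      then have "x \<in> D" "f x \<in> E" using WD V(4) by (auto simp: W_def)
      then show "\<psi>' (h (inv_into E \<psi> (G y))) j = \<psi>' (h (f (inv_into D \<phi> y))) j"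
        by (simp add: x G_def inv inv')
    qed
  qed
  moreover have "openin X W" using is_chart_open_image[OF D WD] oW by simp
  ultimately show ?thesis
    unfolding smooth_in_def using V V' WD by (intro exI[of _ W]) (auto simp: W_def)
qed

text \<open>
  A map into a product is smooth in every product chart as soon as its components are smooth in
  every chart of the factors. This is why products enter through \<open>charted\<close>, and transition maps are
  only considered for the factors.
\<close>

definition charted :: "'m manifold \<Rightarrow> bool" where
  "charted M \<longleftrightarrow>
     (\<forall>D \<phi>. (D, \<phi>) \<in> charts M \<longrightarrow> is_chart (mdim M) (mtop M) D \<phi>) \<and>
     (\<forall>p\<in>points M. \<exists>D \<phi>. (D, \<phi>) \<in> charts M \<and> p \<in> D)"

definition smooth_atlas :: "'m manifold \<Rightarrow> bool" where
  "smooth_atlas M \<longleftrightarrow> charted M \<and>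
     (\<forall>(D, \<phi>)\<in>charts M. \<forall>(E, \<psi>)\<in>charts M. \<forall>j<mdim M.
        C_infinity (mdim M) (\<phi> ` (D \<inter> E)) (\<lambda>x. \<psi> (inv_into D \<phi> x) j))"

lemma smooth_manifold_imp_atlas: "smooth_manifold M \<Longrightarrow> smooth_atlas M"
  unfolding smooth_manifold_def smooth_atlas_def charted_def is_chart_def by fast

lemma smooth_atlas_charted: "smooth_atlas M \<Longrightarrow> charted M"
  by (simp add: smooth_atlas_def)

lemma charted_is_chart: "charted M \<Longrightarrow> (D, \<phi>) \<in> charts M \<Longrightarrow> is_chart (mdim M) (mtop M) D \<phi>"
  unfolding charted_def by blast

lemma charted_chart_at:
  assumes "charted M" "p \<in> points M"
  obtains D \<phi> where "(D, \<phi>) \<in> charts M" "p \<in> D"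
  using assms unfolding charted_def by blast

lemma charted_chart_subset: "charted M \<Longrightarrow> (D, \<phi>) \<in> charts M \<Longrightarrow> D \<subseteq> points M"
  using charted_is_chart openin_subset unfolding is_chart_def by blast

lemma smooth_in_change_of_chart:
  assumes M: "smooth_atlas M" and D: "(D, \<phi>) \<in> charts M" and E: "(E, \<psi>) \<in> charts M"
    and p: "p \<in> D" "p \<in> E"
  shows "smooth_in (mdim M) (mtop M) D \<phi> (mdim M) E \<psi> (\<lambda>x. x) p"
proof -
  have "openin (mtop M) D" "openin (mtop M) E"
    using charted_is_chart[OF smooth_atlas_charted[OF M]] D E by (auto simp: is_chart_def)
  then have "openin (mtop M) (D \<inter> E)" by (rule openin_Int)
  moreover have "\<forall>j<mdim M. C_infinity (mdim M) (\<phi> ` (D \<inter> E)) (\<lambda>x. \<psi> (inv_into D \<phi> x) j)"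
    using M D E unfolding smooth_atlas_def by blast
  ultimately show ?thesis
    unfolding smooth_in_def using p by (intro exI[of _ "D \<inter> E"]) auto
qed

text \<open>
  Smoothness of a map \<open>f\<close> in all charts at \<open>p\<close> and \<open>f p\<close>. In a composition, the chart at \<open>f p\<close> is the
  one in which the outer map happens to be smooth.
\<close>

definition chartwise_smooth_at :: "'m manifold \<Rightarrow> 'n manifold \<Rightarrow> ('m \<Rightarrow> 'n) \<Rightarrow> 'm \<Rightarrow> bool" where
  "chartwise_smooth_at M N f p \<longleftrightarrow> p \<in> points M \<and> f p \<in> points N \<and>
     (\<forall>D \<phi> E \<psi>. (D, \<phi>) \<in> charts M \<longrightarrow> (E, \<psi>) \<in> charts N \<longrightarrow> p \<in> D \<longrightarrow> f p \<in> E \<longrightarrow>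
        smooth_in (mdim M) (mtop M) D \<phi> (mdim N) E \<psi> f p)"

lemma chartwise_smooth_atD:
  "chartwise_smooth_at M N f p \<Longrightarrow> (D, \<phi>) \<in> charts M \<Longrightarrow> (E, \<psi>) \<in> charts N \<Longrightarrow> p \<in> D \<Longrightarrow> f p \<in> E \<Longrightarrow>
     smooth_in (mdim M) (mtop M) D \<phi> (mdim N) E \<psi> f p"
  unfolding chartwise_smooth_at_def by blast

lemma smooth_at_imp_chartwise:
  assumes M: "smooth_atlas M" and N: "smooth_atlas N" and f: "smooth_at M N f p"
  shows "chartwise_smooth_at M N f p"
proof -
  note cM = smooth_atlas_charted[OF M] and cN = smooth_atlas_charted[OF N]
  from f obtain D \<phi> E \<psi> where D: "(D, \<phi>) \<in> charts M" and E: "(E, \<psi>) \<in> charts N"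
    and s: "smooth_in (mdim M) (mtop M) D \<phi> (mdim N) E \<psi> f p"
    unfolding smooth_at_iff_smooth_in by blast
  have p: "p \<in> D" "f p \<in> E" using s unfolding smooth_in_def by blast+
  have "smooth_in (mdim M) (mtop M) D' \<phi>' (mdim N) E' \<psi>' f p"
    if c: "(D', \<phi>') \<in> charts M" "(E', \<psi>') \<in> charts N" "p \<in> D'" "f p \<in> E'" for D' \<phi>' E' \<psi>'
  proof -
    note D' = charted_is_chart[OF cM c(1)]
    have "smooth_in (mdim M) (mtop M) D' \<phi>' (mdim N) E \<psi> f p"
      by (rule smooth_in_compose[OF D' charted_is_chart[OF cM D]
            smooth_in_change_of_chart[OF M c(1) D c(3) p(1)] s])
    from smooth_in_compose[OF D' charted_is_chart[OF cN E] this
        smooth_in_change_of_chart[OF N E c(2) p(2) c(4)]]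
    show ?thesis .
  qed
  then show ?thesis
    using p charted_chart_subset[OF cM D] charted_chart_subset[OF cN E]
    unfolding chartwise_smooth_at_def by blast
qed

lemma chartwise_imp_smooth_at:
  assumes M: "charted M" and N: "charted N" and f: "chartwise_smooth_at M N f p"
  shows "smooth_at M N f p"
proof -
  obtain D \<phi> where "(D, \<phi>) \<in> charts M" "p \<in> D"
    using charted_chart_at[OF M] f unfolding chartwise_smooth_at_def by blast
  moreover obtain E \<psi> where "(E, \<psi>) \<in> charts N" "f p \<in> E"
    using charted_chart_at[OF N] f unfolding chartwise_smooth_at_def by blast
  ultimately show ?thesis
    using chartwise_smooth_atD[OF f] unfolding smooth_at_iff_smooth_in by blast
qed

lemma smooth_at_compose_chartwise:
  assumes M: "charted M" and N: "charted N" and f: "chartwise_smooth_at M N f p"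
    and h: "smooth_at N K h (f p)"
  shows "smooth_at M K (\<lambda>x. h (f x)) p"
proof -
  obtain D \<phi> where D: "(D, \<phi>) \<in> charts M" "p \<in> D"
    using charted_chart_at[OF M] f unfolding chartwise_smooth_at_def by blast
  from h obtain E \<psi> E' \<psi>' where E: "(E, \<psi>) \<in> charts N" and E': "(E', \<psi>') \<in> charts K"
    and s: "smooth_in (mdim N) (mtop N) E \<psi> (mdim K) E' \<psi>' h (f p)"
    unfolding smooth_at_iff_smooth_in by blast
  have "f p \<in> E" using s unfolding smooth_in_def by blast
  then have "smooth_in (mdim M) (mtop M) D \<phi> (mdim N) E \<psi> f p"
    using chartwise_smooth_atD[OF f D(1) E D(2)] by blast
  from smooth_in_compose[OF charted_is_chart[OF M D(1)] charted_is_chart[OF N E] this s]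
  show ?thesis using D(1) E' unfolding smooth_at_iff_smooth_in by blast
qed

lemma smooth_at_compose:
  "smooth_atlas M \<Longrightarrow> smooth_atlas N \<Longrightarrow> smooth_at M N f p \<Longrightarrow> smooth_at N K h (f p) \<Longrightarrow>
     smooth_at M K (\<lambda>x. h (f x)) p"
  by (rule smooth_at_compose_chartwise[OF smooth_atlas_charted smooth_atlas_charted smooth_at_imp_chartwise])

lemma chartwise_smooth_at_const:
  assumes M: "charted M" and p: "p \<in> points M" and c: "c \<in> points N"
  shows "chartwise_smooth_at M N (\<lambda>x. c) p"
proof -
  have "smooth_in (mdim M) (mtop M) D \<phi> (mdim N) E \<psi> (\<lambda>x. c) p"
    if "(D, \<phi>) \<in> charts M" "p \<in> D" "c \<in> E" for D \<phi> E \<psi>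
    using that charted_is_chart[OF M that(1)] unfolding smooth_in_def is_chart_def
    by (intro exI[of _ D]) (auto intro: C_infinity_const)
  then show ?thesis using p c unfolding chartwise_smooth_at_def by blast
qed

lemma chartwise_smooth_at_id:
  "smooth_atlas M \<Longrightarrow> p \<in> points M \<Longrightarrow> chartwise_smooth_at M M (\<lambda>x. x) p"
  unfolding chartwise_smooth_at_def by (blast intro: smooth_in_change_of_chart)

lemma charts_open_submanifold:
  "(C, \<phi>) \<in> charts (open_submanifold M U) \<longleftrightarrow> (\<exists>D. C = D \<inter> U \<and> (D, \<phi>) \<in> charts M)"
  by (auto simp: open_submanifold_def)

lemma smooth_atlas_open_submanifold:
  assumes M: "smooth_atlas M" and U: "openin (mtop M) U"
  shows "smooth_atlas (open_submanifold M U)"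
proof -
  note cM = smooth_atlas_charted[OF M]
  have chart: "is_chart (mdim M) (subtopology (mtop M) U) (D \<inter> U) \<phi>"
    if D: "(D, \<phi>) \<in> charts M" for D \<phi>
  proof -
    have c: "is_chart (mdim M) (mtop M) D \<phi>" by (rule charted_is_chart[OF cM D])
    then have o: "openin (mtop M) (D \<inter> U)" using U by (auto simp: is_chart_def)
    have st: "subtopology (subtopology (mtop M) U) (D \<inter> U) = subtopology (mtop M) (D \<inter> U)"
      by (simp add: subtopology_subtopology Int_absorb1 inf.coboundedI2)
    obtain g where g: "continuous_map (subtopology (Euclidean_space (mdim M)) (\<phi> ` D)) (mtop M) g"
      "\<forall>x\<in>D. g (\<phi> x) = x"
      by (rule is_chart_inverse[OF c])
    show ?thesis
    proof (rule is_chartI[where g = g])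
      show "openin (subtopology (mtop M) U) (D \<inter> U)"
        using o U by (simp add: openin_open_subtopology)
      show "openin (Euclidean_space (mdim M)) (\<phi> ` (D \<inter> U))"
        using is_chart_open_image[OF c] o by simp
      show "continuous_map (subtopology (subtopology (mtop M) U) (D \<inter> U)) euclideanreal (\<lambda>x. \<phi> x i)"
        for i
        unfolding st
        by (rule continuous_map_from_subtopology_mono[OF is_chart_continuous_coordinate[OF c]]) auto
      have "continuous_map (subtopology (Euclidean_space (mdim M)) (\<phi> ` (D \<inter> U))) (mtop M) g"
        by (rule continuous_map_from_subtopology_mono[OF g(1)]) auto
      then show "continuous_map (subtopology (Euclidean_space (mdim M)) (\<phi> ` (D \<inter> U)))
          (subtopology (mtop M) U) g"
        using g(2) by (auto simp: continuous_map_in_subtopology)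
    qed (use g in auto)
  qed
  have sel: "mdim (open_submanifold M U) = mdim M"
    "mtop (open_submanifold M U) = subtopology (mtop M) U"
    by (simp_all add: open_submanifold_def)
  have "\<exists>C \<phi>. (C, \<phi>) \<in> charts (open_submanifold M U) \<and> p \<in> C"
    if "p \<in> points (open_submanifold M U)" for p
  proof -
    have p: "p \<in> points M" "p \<in> U" using that by (simp_all add: sel)
    obtain D \<phi> where "(D, \<phi>) \<in> charts M" "p \<in> D" by (rule charted_chart_at[OF cM p(1)])
    with p(2) show ?thesis unfolding charts_open_submanifold by blast
  qed
  then have "charted (open_submanifold M U)"
    using chart unfolding charted_def charts_open_submanifold sel by blast
  moreover have "C_infinity (mdim M) (\<phi> ` (D \<inter> U \<inter> (E \<inter> U))) (\<lambda>x. \<psi> (inv_into (D \<inter> U) \<phi> x) j)"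
    if D: "(D, \<phi>) \<in> charts M" and E: "(E, \<psi>) \<in> charts M" and j: "j < mdim M" for D \<phi> E \<psi> j
  proof (rule C_infinity_cong)
    have c: "is_chart (mdim M) (mtop M) D \<phi>" by (rule charted_is_chart[OF cM D])
    have o: "openin (mtop M) (D \<inter> U \<inter> (E \<inter> U))"
      using U charted_is_chart[OF cM] D E by (auto simp: is_chart_def)
    then show "openin (Euclidean_space (mdim M)) (\<phi> ` (D \<inter> U \<inter> (E \<inter> U)))"
      using is_chart_open_image[OF c, of "D \<inter> U \<inter> (E \<inter> U)"] by auto
    have "C_infinity (mdim M) (\<phi> ` (D \<inter> E)) (\<lambda>x. \<psi> (inv_into D \<phi> x) j)"
      using M D E j unfolding smooth_atlas_def by blast
    then show "C_infinity (mdim M) (\<phi> ` (D \<inter> U \<inter> (E \<inter> U))) (\<lambda>x. \<psi> (inv_into D \<phi> x) j)"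
      by (rule C_infinity_subset) auto
    fix y assume "y \<in> \<phi> ` (D \<inter> U \<inter> (E \<inter> U))"
    then obtain x where x: "x \<in> D" "x \<in> U" "y = \<phi> x" by blast
    have i: "inj_on \<phi> D" by (rule is_chart_inj[OF c])
    then have "inj_on \<phi> (D \<inter> U)" by (rule inj_on_subset) auto
    then show "\<psi> (inv_into D \<phi> y) j = \<psi> (inv_into (D \<inter> U) \<phi> y) j"
      using x i by simp
  qed
  ultimately show ?thesis
    unfolding smooth_atlas_def sel by (auto simp: charts_open_submanifold)
qed

lemma smooth_atlas_single_chart:
  assumes c: "is_chart (mdim M) (mtop M) (points M) \<phi>" and M: "charts M = {(points M, \<phi>)}"
  shows "smooth_atlas M"
proof -
  have "C_infinity (mdim M) (\<phi> ` points M) (\<lambda>x. \<phi> (inv_into (points M) \<phi> x) j)" for j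
  proof (rule C_infinity_cong[OF _ C_infinity_coordinate])
    show "openin (Euclidean_space (mdim M)) (\<phi> ` points M)" using c by (simp add: is_chart_def)
  qed (simp add: f_inv_into_f)
  then show ?thesis using c by (simp add: smooth_atlas_def charted_def M)
qed

lemma smooth_atlas_real_line: "smooth_atlas real_line"
proof (rule smooth_atlas_single_chart)
  let ?\<rho> = "\<lambda>t i. if i = (0::nat) then t else (0::real)"
  have img: "?\<rho> ` UNIV = topspace (Euclidean_space 1)"
  proof -
    have "x = ?\<rho> (x 0)" if "x \<in> topspace (Euclidean_space 1)" for x
      using that by (auto simp: topspace_Euclidean_space)
    then show ?thesis by (auto simp: topspace_Euclidean_space)
  qed
  have "is_chart 1 euclideanreal UNIV ?\<rho>"
  proof (rule is_chartI[where g = "\<lambda>x. x 0"])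
    show "continuous_map (subtopology (Euclidean_space 1) (?\<rho> ` UNIV)) euclideanreal (\<lambda>x. x 0)"
      by (rule C_infinity_continuous[OF C_infinity_coordinate])
    show "openin (Euclidean_space 1) (?\<rho> ` UNIV)" unfolding img by simp
  qed (auto simp: continuous_map_id[unfolded id_def])
  then show "is_chart (mdim real_line) (mtop real_line) (points real_line) ?\<rho>"
    by (simp add: real_line_def)
qed (simp add: real_line_def)

text \<open>\<open>\<real>\<^sup>n\<close> as a manifold, the parameter space of families with \<open>n\<close> independent times.\<close>

definition coordinate_space :: "nat \<Rightarrow> (nat \<Rightarrow> real) manifold" where
  "coordinate_space n =
     \<lparr> mdim = n, mtop = Euclidean_space n, charts = {(topspace (Euclidean_space n), \<lambda>x. x)} \<rparr>"

lemma smooth_atlas_coordinate_space: "smooth_atlas (coordinate_space n)"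
proof (rule smooth_atlas_single_chart)
  have "is_chart n (Euclidean_space n) (topspace (Euclidean_space n)) (\<lambda>x. x)"
    by (rule is_chartI[where g = "\<lambda>x. x"])
      (auto simp: continuous_map_id[unfolded id_def]
        C_infinity_continuous[OF C_infinity_coordinate, where S = UNIV, simplified])
  then show "is_chart (mdim (coordinate_space n)) (mtop (coordinate_space n))
      (points (coordinate_space n)) (\<lambda>x. x)"
    by (simp add: coordinate_space_def)
qed (simp add: coordinate_space_def)

section \<open>Products of manifolds\<close>

lemma is_chart_prod:
  assumes D: "is_chart m X D \<phi>" and E: "is_chart n Y E \<psi>"
  shows "is_chart (m + n) (prod_topology X Y) (D \<times> E)
    (\<lambda>(x, y) i. if i < m then \<phi> x i else \<psi> y (i - m))"
proof -
  let ?\<Phi> = "\<lambda>(x, y) i. if i < m then \<phi> x i else \<psi> y (i - m)"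
  let ?Z = "Euclidean_space (m + n)"
  define fst_part where "fst_part z = (\<lambda>i. if i < m then z i else 0)" for z :: "nat \<Rightarrow> real"
  define snd_part where "snd_part z = (\<lambda>i. z (i + m))" for z :: "nat \<Rightarrow> real"
  have coord: "continuous_map ?Z euclideanreal (\<lambda>z. z i)" for i
    using C_infinity_continuous[OF C_infinity_coordinate, of "m + n" UNIV] by simp
  have c1: "continuous_map ?Z (Euclidean_space m) fst_part"
    using coord by (intro continuous_map_into_Euclidean) (auto simp: fst_part_def topspace_Euclidean_space)
  have c2: "continuous_map ?Z (Euclidean_space n) snd_part"
    using coord by (intro continuous_map_into_Euclidean) (auto simp: snd_part_def topspace_Euclidean_space)
  have p1: "fst_part (?\<Phi> (x, y)) = \<phi> x" if "x \<in> D" for x y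
    using is_chart_in_Euclidean[OF D that] by (auto simp: fst_part_def topspace_Euclidean_space)
  have p2: "snd_part (?\<Phi> (x, y)) = \<psi> y" for x y
    by (auto simp: snd_part_def)
  have top: "?\<Phi> (x, y) \<in> topspace ?Z" if "x \<in> D" "y \<in> E" for x y
    using is_chart_in_Euclidean[OF E that(2)] by (auto simp: topspace_Euclidean_space)
  have img: "?\<Phi> ` (D \<times> E) =
      {z \<in> topspace ?Z. fst_part z \<in> \<phi> ` D} \<inter> {z \<in> topspace ?Z. snd_part z \<in> \<psi> ` E}"
    (is "_ = ?R")
  proof
    show "?\<Phi> ` (D \<times> E) \<subseteq> ?R"
    proof
      fix z assume "z \<in> ?\<Phi> ` (D \<times> E)"
      then obtain x y where "x \<in> D" "y \<in> E" "z = ?\<Phi> (x, y)" by blast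
      then show "z \<in> ?R" using p1 p2 top by blast
    qed
    show "?R \<subseteq> ?\<Phi> ` (D \<times> E)"
    proof
      fix z assume "z \<in> ?R"
      then obtain x y where xy: "x \<in> D" "y \<in> E" "fst_part z = \<phi> x" "snd_part z = \<psi> y" by blast
      have "z i = ?\<Phi> (x, y) i" for i
        using fun_cong[OF xy(3), of i] fun_cong[OF xy(4), of "i - m"]
        by (auto simp: fst_part_def snd_part_def)
      then show "z \<in> ?\<Phi> ` (D \<times> E)" using xy(1,2) by blast
    qed
  qed
  obtain g where g: "continuous_map (subtopology (Euclidean_space m) (\<phi> ` D)) X g" "\<forall>x\<in>D. g (\<phi> x) = x"
    by (rule is_chart_inverse[OF D])
  obtain h where h: "continuous_map (subtopology (Euclidean_space n) (\<psi> ` E)) Y h" "\<forall>y\<in>E. h (\<psi> y) = y"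
    by (rule is_chart_inverse[OF E])
  show ?thesis
  proof (rule is_chartI[where g = "\<lambda>z. (g (fst_part z), h (snd_part z))"])
    show "openin (prod_topology X Y) (D \<times> E)"
      using D E by (simp add: is_chart_def openin_prod_Times_iff)
    show "openin ?Z (?\<Phi> ` (D \<times> E))"
      unfolding img using D E c1 c2
      by (intro openin_Int openin_continuous_map_preimage) (auto simp: is_chart_def)
    show "continuous_map (subtopology (prod_topology X Y) (D \<times> E)) euclideanreal (\<lambda>z. ?\<Phi> z i)" for i
    proof -
      have "continuous_map (prod_topology (subtopology X D) (subtopology Y E)) euclideanreal
          (\<lambda>z. \<phi> (fst z) i)"
        using continuous_map_compose[OF continuous_map_fst is_chart_continuous_coordinate[OF D]]
        by (simp add: o_def)
      moreover have "continuous_map (prod_topology (subtopology X D) (subtopology Y E)) euclideanreal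
          (\<lambda>z. \<psi> (snd z) (i - m))"
        using continuous_map_compose[OF continuous_map_snd is_chart_continuous_coordinate[OF E]]
        by (simp add: o_def)
      ultimately show ?thesis
        unfolding subtopology_Times by (cases "i < m") (simp_all add: case_prod_beta)
    qed
    have "continuous_map (subtopology ?Z (?\<Phi> ` (D \<times> E))) (subtopology (Euclidean_space m) (\<phi> ` D)) fst_part"
      using continuous_map_from_subtopology[OF c1] img by (auto simp: continuous_map_in_subtopology)
    from continuous_map_compose[OF this g(1)]
    have "continuous_map (subtopology ?Z (?\<Phi> ` (D \<times> E))) X (\<lambda>z. g (fst_part z))" by (simp add: o_def)
    moreover
    have "continuous_map (subtopology ?Z (?\<Phi> ` (D \<times> E))) (subtopology (Euclidean_space n) (\<psi> ` E)) snd_part"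
      using continuous_map_from_subtopology[OF c2] img by (auto simp: continuous_map_in_subtopology)
    from continuous_map_compose[OF this h(1)]
    have "continuous_map (subtopology ?Z (?\<Phi> ` (D \<times> E))) Y (\<lambda>z. h (snd_part z))" by (simp add: o_def)
    ultimately show "continuous_map (subtopology ?Z (?\<Phi> ` (D \<times> E))) (prod_topology X Y)
        (\<lambda>z. (g (fst_part z), h (snd_part z)))"
      by (simp add: continuous_map_pairwise o_def)
    fix z assume "z \<in> D \<times> E"
    then obtain x y where z: "z = (x, y)" "x \<in> D" "y \<in> E" by blast
    show "(g (fst_part (?\<Phi> z)), h (snd_part (?\<Phi> z))) = z"
      unfolding z(1) p1[OF z(2)] p2 using g(2) h(2) z by simp
  qed
qed

lemma charts_prodI:
  "(D, \<phi>) \<in> charts M \<Longrightarrow> (E, \<psi>) \<in> charts N \<Longrightarrow>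
     (D \<times> E, \<lambda>(x, y) i. if i < mdim M then \<phi> x i else \<psi> y (i - mdim M)) \<in> charts (prod_manifold M N)"
  unfolding prod_manifold_def manifold.select_convs by blast

lemma charted_prod:
  assumes M: "charted M" and N: "charted N"
  shows "charted (prod_manifold M N)"
proof -
  have "\<exists>C \<Phi>. (C, \<Phi>) \<in> charts (prod_manifold M N) \<and> z \<in> C" if "z \<in> points (prod_manifold M N)" for z
  proof -
    obtain x y where z: "z = (x, y)" "x \<in> points M" "y \<in> points N"
      using \<open>z \<in> points (prod_manifold M N)\<close> by (auto simp: prod_manifold_def)
    obtain D \<phi> where D: "(D, \<phi>) \<in> charts M" and "x \<in> D" by (rule charted_chart_at[OF M z(2)])
    moreover obtain E \<psi> where E: "(E, \<psi>) \<in> charts N" and "y \<in> E" by (rule charted_chart_at[OF N z(3)])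
    ultimately have "z \<in> D \<times> E" using z(1) by blast
    with charts_prodI[OF D E] show ?thesis by blast
  qed
  then show ?thesis
    using is_chart_prod[OF charted_is_chart[OF M] charted_is_chart[OF N]]
    unfolding charted_def by (auto simp: prod_manifold_def)
qed

lemma chartwise_smooth_at_Pair:
  assumes f: "chartwise_smooth_at K M f p" and g: "chartwise_smooth_at K N g p"
  shows "chartwise_smooth_at K (prod_manifold M N) (\<lambda>x. (f x, g x)) p"
proof -
  let ?\<Phi> = "\<lambda>\<psi> \<psi>'. \<lambda>(x, y) i. if i < mdim M then \<psi> x i else \<psi>' y (i - mdim M)"
  have "smooth_in (mdim K) (mtop K) D \<phi> (mdim M + mdim N) (E \<times> E') (?\<Phi> \<psi> \<psi>') (\<lambda>x. (f x, g x)) p"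
    if D: "(D, \<phi>) \<in> charts K" "p \<in> D" and E: "(E, \<psi>) \<in> charts M" "f p \<in> E"
      and E': "(E', \<psi>') \<in> charts N" "g p \<in> E'" for D \<phi> E \<psi> E' \<psi>'
  proof -
    from chartwise_smooth_atD[OF f D(1) E(1) D(2) E(2)]
    obtain V where V: "openin (mtop K) V" "p \<in> V" "V \<subseteq> D" "f ` V \<subseteq> E"
      and fC: "\<And>j. j < mdim M \<Longrightarrow> C_infinity (mdim K) (\<phi> ` V) (\<lambda>x. \<psi> (f (inv_into D \<phi> x)) j)"
      unfolding smooth_in_def by blast
    from chartwise_smooth_atD[OF g D(1) E'(1) D(2) E'(2)]
    obtain V' where V': "openin (mtop K) V'" "p \<in> V'" "V' \<subseteq> D" "g ` V' \<subseteq> E'"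
      and gC: "\<And>j. j < mdim N \<Longrightarrow> C_infinity (mdim K) (\<phi> ` V') (\<lambda>x. \<psi>' (g (inv_into D \<phi> x)) j)"
      unfolding smooth_in_def by blast
    have "C_infinity (mdim K) (\<phi> ` (V \<inter> V'))
        (\<lambda>x. ?\<Phi> \<psi> \<psi>' (f (inv_into D \<phi> x), g (inv_into D \<phi> x)) j)" if "j < mdim M + mdim N" for j
    proof (cases "j < mdim M")
      case True
      with C_infinity_subset[OF fC[OF True], of "\<phi> ` (V \<inter> V')"] show ?thesis by auto
    next
      case False
      with that have "j - mdim M < mdim N" by auto
      with False C_infinity_subset[OF gC, of "j - mdim M" "\<phi> ` (V \<inter> V')"] show ?thesis by auto
    qed
    then show ?thesis
      unfolding smooth_in_def using V V' by (intro exI[of _ "V \<inter> V'"]) (auto simp del: split_conv)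
  qed
  then show ?thesis
    using f g unfolding chartwise_smooth_at_def by (auto simp: prod_manifold_def)
qed

text \<open>
  The coordinates of the factor \<open>l\<close> are the block of indices from \<open>l d\<close> to \<open>l d + d - 1\<close>; cutting out
  this block inverts the concatenation.
\<close>

lemma is_chart_power:
  assumes D: "\<And>l. l < r \<Longrightarrow> is_chart d X (D l) (\<phi> l)"
  shows "is_chart (r * d) (product_topology (\<lambda>_. X) {..<r}) (PiE {..<r} D)
    (\<lambda>x i. if i < r * d then \<phi> (i div d) (x (i div d)) (i mod d) else 0)"
proof -
  let ?\<Phi> = "\<lambda>x i. if i < r * d then \<phi> (i div d) (x (i div d)) (i mod d) else 0"
  let ?Z = "Euclidean_space (r * d)" and ?P = "product_topology (\<lambda>_. X) {..<r}"
  define block where "block l z = (\<lambda>i. if i < d then z (l * d + i) else 0)"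
    for l and z :: "nat \<Rightarrow> real"
  have coord: "continuous_map ?Z euclideanreal (\<lambda>z. z i)" for i
    using C_infinity_continuous[OF C_infinity_coordinate, of "r * d" UNIV] by simp
  have cb: "continuous_map ?Z (Euclidean_space d) (block l)" for l
    using coord by (intro continuous_map_into_Euclidean) (auto simp: block_def topspace_Euclidean_space)
  have lt: "l * d + i < r * d" if "l < r" "i < d" for l i
  proof -
    have "l * d + i < Suc l * d" using that(2) by simp
    also have "\<dots> \<le> r * d" using that(1) by (intro mult_right_mono) auto
    finally show ?thesis .
  qed
  have split: "i div d < r \<and> i mod d < d" if "i < r * d" for i
    using that by (cases "d = 0") (auto simp: less_mult_imp_div_less)
  have b: "block l (?\<Phi> x) = \<phi> l (x l)" if "l < r" "x l \<in> D l" for l x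
  proof
    fix i
    show "block l (?\<Phi> x) i = \<phi> l (x l) i"
      using lt[OF that(1)] is_chart_in_Euclidean[OF D that(2)] that(1)
      by (auto simp: block_def topspace_Euclidean_space)
  qed
  have img: "?\<Phi> ` (PiE {..<r} D) =
      topspace ?Z \<inter> (\<Inter>l\<in>{..<r}. {z \<in> topspace ?Z. block l z \<in> \<phi> l ` D l})" (is "_ = ?R")
  proof
    show "?\<Phi> ` (PiE {..<r} D) \<subseteq> ?R"
    proof
      fix z assume "z \<in> ?\<Phi> ` (PiE {..<r} D)"
      then obtain x where x: "x \<in> PiE {..<r} D" "z = ?\<Phi> x" by blast
      then have "z \<in> topspace ?Z" by (simp add: topspace_Euclidean_space)
      moreover have "block l z \<in> \<phi> l ` D l" if "l < r" for l
      proof -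
        have "x l \<in> D l" using x(1) that by auto
        then show ?thesis unfolding x(2) using b[OF that, of x] by blast
      qed
      ultimately show "z \<in> ?R" by blast
    qed
    show "?R \<subseteq> ?\<Phi> ` (PiE {..<r} D)"
    proof
      fix z assume z: "z \<in> ?R"
      then have "\<forall>l\<in>{..<r}. \<exists>y. y \<in> D l \<and> block l z = \<phi> l y" by blast
      from bchoice[OF this] obtain y where y: "\<And>l. l < r \<Longrightarrow> y l \<in> D l \<and> block l z = \<phi> l (y l)" by auto
      have "z i = ?\<Phi> (restrict y {..<r}) i" for i
      proof (cases "i < r * d")
        case True
        have "z i = block (i div d) z (i mod d)"
          using split[OF True] by (simp add: block_def)
        then show ?thesis using y split[OF True] True by simp
      qed (use z in \<open>auto simp: topspace_Euclidean_space\<close>)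
      then show "z \<in> ?\<Phi> ` (PiE {..<r} D)"
        using y by (intro image_eqI[where x = "restrict y {..<r}"]) auto
    qed
  qed
  have "\<forall>l\<in>{..<r}. \<exists>g. continuous_map (subtopology (Euclidean_space d) (\<phi> l ` D l)) X g \<and>
      (\<forall>x\<in>D l. g (\<phi> l x) = x)"
    using is_chart_inverse[OF D] by (metis lessThan_iff)
  from bchoice[OF this] obtain g where
    g: "\<And>l. l < r \<Longrightarrow> continuous_map (subtopology (Euclidean_space d) (\<phi> l ` D l)) X (g l)"
      "\<And>l x. l < r \<Longrightarrow> x \<in> D l \<Longrightarrow> g l (\<phi> l x) = x" by auto
  show ?thesis
  proof (rule is_chartI[where g = "\<lambda>z. \<lambda>l\<in>{..<r}. g l (block l z)"])
    show "openin ?P (PiE {..<r} D)"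
      using D by (subst openin_PiE_gen) (auto simp: is_chart_def)
    show "openin ?Z (?\<Phi> ` (PiE {..<r} D))"
    proof -
      have "openin ?Z {z \<in> topspace ?Z. block l z \<in> \<phi> l ` D l}" if "l < r" for l
        using D[OF that] by (intro openin_continuous_map_preimage[OF cb]) (simp add: is_chart_def)
      then show ?thesis unfolding img by (cases "r = 0") auto
    qed
    show "continuous_map (subtopology ?P (PiE {..<r} D)) euclideanreal (\<lambda>x. ?\<Phi> x i)"
      if i: "i < r * d" for i
    proof -
      have l: "i div d < r" using split[OF i] by blast
      have "continuous_map (subtopology ?P (PiE {..<r} D)) (subtopology X (D (i div d))) (\<lambda>x. x (i div d))"
        using l continuous_map_from_subtopology[OF continuous_map_product_projection, of "i div d" "{..<r}"]
        by (auto simp: continuous_map_in_subtopology)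
      from continuous_map_compose[OF this is_chart_continuous_coordinate[OF D[OF l]]] i
      show ?thesis by (simp add: o_def)
    qed
    have "continuous_map (subtopology ?Z (?\<Phi> ` (PiE {..<r} D))) X (\<lambda>z. g l (block l z))" if "l < r" for l
    proof -
      have "continuous_map (subtopology ?Z (?\<Phi> ` (PiE {..<r} D)))
          (subtopology (Euclidean_space d) (\<phi> l ` D l)) (block l)"
        using continuous_map_from_subtopology[OF cb] that unfolding img
        by (auto simp: continuous_map_in_subtopology)
      from continuous_map_compose[OF this g(1)[OF that]] show ?thesis by (simp add: o_def)
    qed
    then show "continuous_map (subtopology ?Z (?\<Phi> ` (PiE {..<r} D))) ?P (\<lambda>z. \<lambda>l\<in>{..<r}. g l (block l z))"
      by (auto simp: continuous_map_componentwise cong: restrict_cong)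
    fix x assume x: "x \<in> PiE {..<r} D"
    have "(\<lambda>l\<in>{..<r}. g l (block l (?\<Phi> x))) l = x l" for l
    proof (cases "l < r")
      case True
      then have "x l \<in> D l" using x by auto
      then show ?thesis using True b[OF True, of x] g(2) by simp
    qed (use x in \<open>auto simp: PiE_def extensional_def\<close>)
    then show "(\<lambda>l\<in>{..<r}. g l (block l (?\<Phi> x))) = x" by blast
  qed
qed

lemma charts_powerI:
  "(\<And>l. l < r \<Longrightarrow> (D l, \<phi> l) \<in> charts M) \<Longrightarrow>
     (PiE {..<r} D, \<lambda>x i. if i < r * mdim M then \<phi> (i div mdim M) (x (i div mdim M)) (i mod mdim M) else 0)
       \<in> charts (power_manifold r M)"
  unfolding power_manifold_def manifold.select_convs by blast

lemma charted_power:
  assumes M: "charted M"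
  shows "charted (power_manifold r M)"
proof -
  have "\<exists>C \<Phi>. (C, \<Phi>) \<in> charts (power_manifold r M) \<and> x \<in> C" if x: "x \<in> points (power_manifold r M)" for x
  proof -
    have x': "x \<in> (\<Pi>\<^sub>E l\<in>{..<r}. points M)" using x by (simp add: power_manifold_def)
    have "\<exists>c. c \<in> charts M \<and> x l \<in> fst c" if "l < r" for l
    proof -
      have "x l \<in> points M" using x' that by auto
      from charted_chart_at[OF M this] show ?thesis by (metis fst_conv)
    qed
    then obtain c where c: "\<And>l. l < r \<Longrightarrow> c l \<in> charts M \<and> x l \<in> fst (c l)" by metis
    then have "x \<in> PiE {..<r} (\<lambda>l. fst (c l))" using x' by (auto simp: PiE_iff)
    moreover have "(fst (c l), snd (c l)) \<in> charts M" if "l < r" for l using c[OF that] by simp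
    ultimately show ?thesis
      using charts_powerI[of r "\<lambda>l. fst (c l)" "\<lambda>l. snd (c l)" M] by blast
  qed
  then show ?thesis
    using is_chart_power[OF charted_is_chart[OF M], of r]
    unfolding charted_def by (auto simp: power_manifold_def)
qed

lemma chartwise_smooth_at_power:
  assumes K: "charted K" "p \<in> points K"
    and f: "\<And>l. l < r \<Longrightarrow> chartwise_smooth_at K M (f l) p"
  shows "chartwise_smooth_at K (power_manifold r M) (\<lambda>x. \<lambda>l\<in>{..<r}. f l x) p"
proof -
  let ?d = "mdim M"
  let ?\<Phi> = "\<lambda>\<psi> x i. if i < r * ?d then \<psi> (i div ?d) (x (i div ?d)) (i mod ?d) else 0"
  have "smooth_in (mdim K) (mtop K) D \<phi> (r * ?d) (PiE {..<r} E) (?\<Phi> \<psi>) (\<lambda>x. \<lambda>l\<in>{..<r}. f l x) p"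
    if D: "(D, \<phi>) \<in> charts K" "p \<in> D" and E: "\<And>l. l < r \<Longrightarrow> (E l, \<psi> l) \<in> charts M"
      "\<And>l. l < r \<Longrightarrow> f l p \<in> E l" for D \<phi> E and \<psi> :: "nat \<Rightarrow> 'b \<Rightarrow> nat \<Rightarrow> real"
  proof -
    have "\<forall>l\<in>{..<r}. \<exists>V. openin (mtop K) V \<and> p \<in> V \<and> V \<subseteq> D \<and> f l ` V \<subseteq> E l \<and>
        (\<forall>j<?d. C_infinity (mdim K) (\<phi> ` V) (\<lambda>x. \<psi> l (f l (inv_into D \<phi> x)) j))"
      using chartwise_smooth_atD[OF f D(1) E(1) D(2) E(2)] unfolding smooth_in_def by blast
    from bchoice[OF this] obtain V where
      VC: "\<forall>l\<in>{..<r}. openin (mtop K) (V l) \<and> p \<in> V l \<and> V l \<subseteq> D \<and> f l ` V l \<subseteq> E l \<and>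
        (\<forall>j<?d. C_infinity (mdim K) (\<phi> ` V l) (\<lambda>x. \<psi> l (f l (inv_into D \<phi> x)) j))" by blast
    then have V: "openin (mtop K) (V l) \<and> p \<in> V l \<and> V l \<subseteq> D \<and> f l ` V l \<subseteq> E l" if "l < r" for l
      using that by blast
    have C: "C_infinity (mdim K) (\<phi> ` V l) (\<lambda>x. \<psi> l (f l (inv_into D \<phi> x)) j)"
      if "l < r" "j < ?d" for l j
      using VC that by blast
    define W where "W = D \<inter> (\<Inter>l\<in>{..<r}. V l)"
    have "openin (mtop K) D" using charted_is_chart[OF K(1) D(1)] by (simp add: is_chart_def)
    then have "openin (mtop K) W" using V unfolding W_def by (cases "r = 0") auto
    moreover have "p \<in> W" using V D(2) by (auto simp: W_def)
    moreover have "W \<subseteq> D" by (auto simp: W_def)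
    moreover have "(\<lambda>x. \<lambda>l\<in>{..<r}. f l x) ` W \<subseteq> PiE {..<r} E"
    proof (rule image_subsetI)
      fix x assume "x \<in> W"
      then have "f l x \<in> E l" if "l < r" for l using V[OF that] that unfolding W_def by blast
      then show "(\<lambda>l\<in>{..<r}. f l x) \<in> PiE {..<r} E" by simp
    qed
    moreover have "C_infinity (mdim K) (\<phi> ` W) (\<lambda>x. ?\<Phi> \<psi> (\<lambda>l\<in>{..<r}. f l (inv_into D \<phi> x)) j)"
      if j: "j < r * ?d" for j
    proof -
      have l: "j div ?d < r" "j mod ?d < ?d"
        using j by (cases "?d = 0", auto simp: less_mult_imp_div_less)+
      have "C_infinity (mdim K) (\<phi> ` W) (\<lambda>x. \<psi> (j div ?d) (f (j div ?d) (inv_into D \<phi> x)) (j mod ?d))"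
        using l by (intro C_infinity_subset[OF C[OF l]]) (auto simp: W_def)
      then show ?thesis using j l by simp
    qed
    ultimately show ?thesis unfolding smooth_in_def by blast
  qed
  moreover have "f l p \<in> points M" if "l < r" for l
    using f[OF that] by (simp add: chartwise_smooth_at_def)
  ultimately show ?thesis
    using K(2) unfolding chartwise_smooth_at_def power_manifold_def by (auto simp: PiE_iff)
qed

section \<open>The first variation of a function on the reduced space\<close>

lemma charts_real_line: "charts real_line = {(UNIV, \<lambda>t i. if i = 0 then t else 0)}"
  and mdim_real_line: "mdim real_line = 1"
  and mtop_real_line: "mtop real_line = euclideanreal"
  by (simp_all add: real_line_def)

lemma smooth_in_real_line:
  "smooth_in m X D \<phi> (mdim real_line) UNIV (\<lambda>t i. if i = 0 then t else 0) f p \<longleftrightarrow>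
     (\<exists>V. openin X V \<and> p \<in> V \<and> V \<subseteq> D \<and> C_infinity m (\<phi> ` V) (\<lambda>x. f (inv_into D \<phi> x)))"
  by (simp add: smooth_in_def mdim_real_line)

lemma smooth_at_real_line_iff:
  "smooth_at M real_line f p \<longleftrightarrow> (\<exists>(D, \<phi>)\<in>charts M. \<exists>V. openin (mtop M) V \<and> p \<in> V \<and> V \<subseteq> D \<and>
     C_infinity (mdim M) (\<phi> ` V) (\<lambda>x. f (inv_into D \<phi> x)))"
  unfolding smooth_at_iff_smooth_in by (simp add: charts_real_line smooth_in_real_line)

lemma smooth_at_coordinate_space:
  "smooth_at (coordinate_space n) real_line f x \<longleftrightarrow>
     (\<exists>V. openin (Euclidean_space n) V \<and> x \<in> V \<and> C_infinity n V f)"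
proof -
  have eq: "C_infinity n V (\<lambda>y. f (inv_into (topspace (Euclidean_space n)) (\<lambda>x. x) y)) \<longleftrightarrow> C_infinity n V f"
    if V: "openin (Euclidean_space n) V" for V
  proof -
    have "inv_into (topspace (Euclidean_space n)) (\<lambda>x. x) y = y" if "y \<in> V" for y
      using inv_into_f_f[of "\<lambda>x. x" "topspace (Euclidean_space n)" y] openin_subset[OF V] that
      by (auto simp: inj_on_def)
    then show ?thesis
      using C_infinity_cong[OF V, of "\<lambda>y. f (inv_into (topspace (Euclidean_space n)) (\<lambda>x. x) y)" f]
        C_infinity_cong[OF V, of f "\<lambda>y. f (inv_into (topspace (Euclidean_space n)) (\<lambda>x. x) y)"]
      by auto
  qed
  have "smooth_at (coordinate_space n) real_line f x \<longleftrightarrow>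
     (\<exists>V. openin (Euclidean_space n) V \<and> x \<in> V \<and> V \<subseteq> topspace (Euclidean_space n) \<and>
        C_infinity n V (\<lambda>y. f (inv_into (topspace (Euclidean_space n)) (\<lambda>x. x) y)))"
    unfolding smooth_at_real_line_iff by (simp add: coordinate_space_def)
  then show ?thesis using eq openin_subset by blast
qed

lemma smooth_at_real_line_differentiable:
  assumes "smooth_at real_line real_line f t"
  obtains d where "(f has_real_derivative d) (at t)"
proof -
  let ?\<rho> = "\<lambda>t i. if i = (0::nat) then t else (0::real)"
  obtain V where V: "t \<in> V" "C_infinity 1 (?\<rho> ` V) (\<lambda>x. f (inv_into UNIV ?\<rho> x))"
    using assms unfolding smooth_at_real_line_iff by (auto simp: charts_real_line mdim_real_line)
  have inv: "inv_into UNIV ?\<rho> (?\<rho> s) = s" for s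
    by (rule inv_into_f_f) (auto simp: inj_def fun_eq_iff split: if_splits)
  have upd: "(?\<rho> t)(0 := s) = ?\<rho> s" for s
    by auto
  from V(2) have "C_class 1 (?\<rho> ` V) (Suc 0) (\<lambda>x. f (inv_into UNIV ?\<rho> x))"
    unfolding C_infinity_def by blast
  then obtain f' where "partial_derivatives 1 (?\<rho> ` V) (\<lambda>x. f (inv_into UNIV ?\<rho> x)) f'"
    unfolding C_class_Suc by blast
  from partial_derivativesD[OF this, of 0 "?\<rho> t"] V(1)
  have "((\<lambda>s. f (inv_into UNIV ?\<rho> ((?\<rho> t)(0 := s)))) has_real_derivative f' 0 (?\<rho> t)) (at t)"
    by simp
  then show ?thesis unfolding upd inv using that by blast
qed

lemma smooth_at_compose_reduced:
  assumes K: "charted K" "x \<in> points K" and MU: "charted MU" and MG: "charted MG"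
    and f: "\<And>j. j < k + 1 \<Longrightarrow> chartwise_smooth_at K MU (f j) x"
    and h: "\<And>j. j < k \<Longrightarrow> chartwise_smooth_at K MG (h j) x"
    and F: "smooth_map (reduced_space k MU MG) real_line F"
  shows "smooth_at K real_line (\<lambda>x. F (\<lambda>j\<in>{..<k + 1}. f j x, \<lambda>j\<in>{..<k}. h j x)) x"
proof -
  have c: "chartwise_smooth_at K (reduced_space k MU MG) (\<lambda>x. (\<lambda>j\<in>{..<k + 1}. f j x, \<lambda>j\<in>{..<k}. h j x)) x"
    unfolding reduced_space_def
    by (intro chartwise_smooth_at_Pair chartwise_smooth_at_power K f h)
  then have "(\<lambda>j\<in>{..<k + 1}. f j x, \<lambda>j\<in>{..<k}. h j x) \<in> points (reduced_space k MU MG)"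
    by (simp add: chartwise_smooth_at_def)
  then have "smooth_at (reduced_space k MU MG) real_line F (\<lambda>j\<in>{..<k + 1}. f j x, \<lambda>j\<in>{..<k}. h j x)"
    using F unfolding smooth_map_def by blast
  moreover have "charted (reduced_space k MU MG)"
    unfolding reduced_space_def by (intro charted_prod charted_power MU MG)
  ultimately show ?thesis using smooth_at_compose_chartwise[OF K(1) _ c] by blast
qed

text \<open>
  Giving each of the \<open>2k + 1\<close> entries its own time turns \<open>F\<close> along the curves into a smooth
  function of \<open>2k + 1\<close> real variables. The derivative along the diagonal is the sum of the
  partial derivatives, and each partial derivative is the velocity of one entry applied to the
  restriction of \<open>F\<close> to that entry.
\<close>

lemma derivative_along_curves:
  fixes F :: "('b, 'g) dpoint \<Rightarrow> real" and P :: "nat \<Rightarrow> real \<Rightarrow> 'b" and H :: "nat \<Rightarrow> real \<Rightarrow> 'g"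
  assumes MU: "smooth_atlas MU" and MG: "smooth_atlas MG"
    and F: "smooth_map (reduced_space k MU MG) real_line F"
    and P: "\<And>j. j < k + 1 \<Longrightarrow> smooth_at real_line MU (P j) 0"
    and H: "\<And>j. j < k \<Longrightarrow> smooth_at real_line MG (H j) 0"
  defines "a \<equiv> (\<lambda>j\<in>{..<k + 1}. P j 0, \<lambda>j\<in>{..<k}. H j 0)"
  shows "((\<lambda>t. F (\<lambda>j\<in>{..<k + 1}. P j t, \<lambda>j\<in>{..<k}. H j t)) has_real_derivative
      (\<Sum>i=1..k + 1. D_base i F a (velocity MU (P (i - 1)))) +
      (\<Sum>z=k + 2..2 * k + 1. D_group k z F a (velocity MG (H (z - (k + 2)))))) (at 0)"
proof -
  define n where "n = 2 * k + 1"
  (* Entry j of the first family runs on the time x j, entry j of the second on x (k + 1 + j). *)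
  define \<Psi> where "\<Psi> x = (\<lambda>j\<in>{..<k + 1}. P j (x j), \<lambda>j\<in>{..<k}. H j (x (k + 1 + j)))" for x
  let ?o = "\<lambda>_::nat. 0::real"
  let ?R = "coordinate_space n"
  note cU = smooth_atlas_charted[OF MU] and cG = smooth_atlas_charted[OF MG]
  note R = smooth_atlas_coordinate_space[of n]
  have o: "?o \<in> points ?R" by (simp add: coordinate_space_def topspace_Euclidean_space)
  have Po: "P j 0 \<in> points MU" if "j < k + 1" for j
    using smooth_at_imp_chartwise[OF smooth_atlas_real_line MU P[OF that]]
    by (simp add: chartwise_smooth_at_def)
  have Ho: "H j 0 \<in> points MG" if "j < k" for j
    using smooth_at_imp_chartwise[OF smooth_atlas_real_line MG H[OF that]]
    by (simp add: chartwise_smooth_at_def)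
  have proj: "smooth_at ?R real_line (\<lambda>x. x j) ?o" for j
    unfolding smooth_at_coordinate_space using o
    by (intro exI[of _ "topspace (Euclidean_space n)"])
      (auto simp: coordinate_space_def C_infinity_coordinate)
  have "smooth_at ?R real_line (\<lambda>x. F (\<Psi> x)) ?o"
    unfolding \<Psi>_def
  proof (rule smooth_at_compose_reduced[OF smooth_atlas_charted[OF R] o cU cG _ _ F])
    show "chartwise_smooth_at ?R MU (\<lambda>x. P j (x j)) ?o" if "j < k + 1" for j
      by (intro smooth_at_imp_chartwise[OF R MU]
          smooth_at_compose[OF R smooth_atlas_real_line proj] P that)
    show "chartwise_smooth_at ?R MG (\<lambda>x. H j (x (k + 1 + j))) ?o" if "j < k" for j
      by (intro smooth_at_imp_chartwise[OF R MG]
          smooth_at_compose[OF R smooth_atlas_real_line proj] H that)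
  qed
  then obtain V where V: "openin (Euclidean_space n) V" "?o \<in> V" and CV: "C_infinity n V (\<lambda>x. F (\<Psi> x))"
    unfolding smooth_at_coordinate_space by blast
  from CV have "C_class n V (Suc 0) (\<lambda>x. F (\<Psi> x))" unfolding C_infinity_def by blast
  then obtain f' where f': "partial_derivatives n V (\<lambda>x. F (\<Psi> x)) f'"
    and cont: "\<And>j. j < n \<Longrightarrow> continuous_map (subtopology (Euclidean_space n) V) euclideanreal (f' j)"
    unfolding C_class_Suc C_class.simps(1) by blast
  have axis: "((\<lambda>t. F (\<Psi> (?o(j := t)))) has_real_derivative f' j ?o) (at 0)" if "j < n" for j
    using partial_derivativesD[OF f' that V(2)] by simp
  have base: "D_base i F a (velocity MU (P (i - 1))) = f' (i - 1) ?o" if i: "i \<in> {1..k + 1}" for i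
  proof -
    define l where "l = i - 1"
    have l: "l < k + 1" using i by (auto simp: l_def)
    have slice: "((fst a)(l := x), snd a) =
        (\<lambda>j\<in>{..<k + 1}. if j = l then x else P j 0, \<lambda>j\<in>{..<k}. H j 0)" for x
      using l by (auto simp: a_def fun_eq_iff)
    have "smooth_at MU real_line (\<lambda>x. F ((fst a)(l := x), snd a)) (P l 0)"
      unfolding slice
    proof (rule smooth_at_compose_reduced[OF cU Po[OF l] cU cG _ _ F])
      show "chartwise_smooth_at MU MU (\<lambda>x. if j = l then x else P j 0) (P l 0)"
        if "j < k + 1" for j
        using chartwise_smooth_at_id[OF MU Po[OF l]] chartwise_smooth_at_const[OF cU Po[OF l] Po[OF that]]
        by (cases "j = l") simp_all
      show "chartwise_smooth_at MU MG (\<lambda>x. H j 0) (P l 0)" if "j < k" for j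
        by (rule chartwise_smooth_at_const[OF cU Po[OF l] Ho[OF that]])
    qed
    moreover have "\<Psi> (?o(l := t)) = ((fst a)(l := P l t), snd a)" for t
      using l unfolding slice by (auto simp: \<Psi>_def fun_eq_iff)
    ultimately show ?thesis
      using DERIV_imp_deriv[OF axis[of "l"]] l
      by (simp add: D_base_def velocity_def n_def flip: l_def One_nat_def)
  qed
  have group: "D_group k z F a (velocity MG (H (z - (k + 2)))) = f' (z - 1) ?o"
    if z: "z \<in> {k + 2..2 * k + 1}" for z
  proof -
    define l where "l = z - (k + 2)"
    have l: "l < k" and zl: "z - 1 = k + 1 + l" using z by (auto simp: l_def)
    have slice: "(fst a, (snd a)(l := x)) =
        (\<lambda>j\<in>{..<k + 1}. P j 0, \<lambda>j\<in>{..<k}. if j = l then x else H j 0)" for x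
      using l by (auto simp: a_def fun_eq_iff)
    have "smooth_at MG real_line (\<lambda>x. F (fst a, (snd a)(l := x))) (H l 0)"
      unfolding slice
    proof (rule smooth_at_compose_reduced[OF cG Ho[OF l] cU cG _ _ F])
      show "chartwise_smooth_at MG MG (\<lambda>x. if j = l then x else H j 0) (H l 0)" if "j < k" for j
        using chartwise_smooth_at_id[OF MG Ho[OF l]] chartwise_smooth_at_const[OF cG Ho[OF l] Ho[OF that]]
        by (cases "j = l") simp_all
      show "chartwise_smooth_at MG MU (\<lambda>x. P j 0) (H l 0)" if "j < k + 1" for j
        by (rule chartwise_smooth_at_const[OF cG Ho[OF l] Po[OF that]])
    qed
    moreover have "\<Psi> (?o(z - 1 := t)) = (fst a, (snd a)(l := H l t))" for t
      using l unfolding slice zl by (auto simp: \<Psi>_def fun_eq_iff)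
    moreover have "z - 1 < n" using l zl by (simp add: n_def)
    ultimately show ?thesis
      using DERIV_imp_deriv[OF axis[of "z - 1"]]
      unfolding D_group_def velocity_def l_def[symmetric] by simp
  qed
  define c where "c t = (\<lambda>i. if i < n then t else 0)" for t :: real
  have c0: "c 0 = ?o" by (auto simp: c_def)
  have "((\<lambda>t. F (\<Psi> (c t))) has_real_derivative (\<Sum>j<n. f' j (c 0) * 1)) (at 0)"
  proof (rule chain_rule_along_curve[OF V(1) _ f' cont])
    show "c 0 \<in> V" using V(2) by (simp add: c0)
    show "eventually (\<lambda>t. c t \<in> topspace (Euclidean_space n)) (at 0)"
      by (simp add: c_def topspace_Euclidean_space)
    show "((\<lambda>t. c t j) has_real_derivative 1) (at 0)" if "j < n" for j
      using that by (simp add: c_def)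
  qed
  moreover have "\<Psi> (c t) = (\<lambda>j\<in>{..<k + 1}. P j t, \<lambda>j\<in>{..<k}. H j t)" for t
    by (auto simp: \<Psi>_def c_def n_def)
  moreover have "(\<Sum>j<n. f' j ?o) = (\<Sum>i=1..k + 1. f' (i - 1) ?o) + (\<Sum>z=k + 2..2 * k + 1. f' (z - 1) ?o)"
  proof -
    have "(\<Sum>j<n. f' j ?o) = (\<Sum>i=1..n. f' (i - 1) ?o)"
      by (simp add: sum.atLeast1_atMost_eq)
    also have "{1..n} = {1..k + 1} \<union> {k + 2..2 * k + 1}" by (auto simp: n_def)
    finally show ?thesis by (subst (asm) sum.union_disjoint) auto
  qed
  moreover have "(\<Sum>i=1..k + 1. D_base i F a (velocity MU (P (i - 1)))) = (\<Sum>i=1..k + 1. f' (i - 1) ?o)"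
    by (intro sum.cong refl base)
  moreover have "(\<Sum>z=k + 2..2 * k + 1. D_group k z F a (velocity MG (H (z - (k + 2))))) =
      (\<Sum>z=k + 2..2 * k + 1. f' (z - 1) ?o)"
    by (intro sum.cong refl group)
  ultimately show ?thesis by (simp only: c0 mult_1_right)
qed

section \<open>Tangent vectors and translations\<close>

lemma smooth_at_real_in_chart:
  assumes M: "smooth_atlas M" and D: "(D, \<phi>) \<in> charts M" "p \<in> D"
  shows "smooth_at M real_line f p \<longleftrightarrow> (\<exists>V. openin (mtop M) V \<and> p \<in> V \<and> V \<subseteq> D \<and>
    C_infinity (mdim M) (\<phi> ` V) (\<lambda>x. f (inv_into D \<phi> x)))"
proof
  assume "smooth_at M real_line f p"
  from chartwise_smooth_atD[OF smooth_at_imp_chartwise[OF M smooth_atlas_real_line this] D(1) _ D(2)]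
  have "smooth_in (mdim M) (mtop M) D \<phi> (mdim real_line) UNIV (\<lambda>t i. if i = 0 then t else 0) f p"
    by (simp add: charts_real_line)
  then show "\<exists>V. openin (mtop M) V \<and> p \<in> V \<and> V \<subseteq> D \<and>
    C_infinity (mdim M) (\<phi> ` V) (\<lambda>x. f (inv_into D \<phi> x))"
    by (simp only: smooth_in_real_line)
next
  assume "\<exists>V. openin (mtop M) V \<and> p \<in> V \<and> V \<subseteq> D \<and>
    C_infinity (mdim M) (\<phi> ` V) (\<lambda>x. f (inv_into D \<phi> x))"
  then show "smooth_at M real_line f p" unfolding smooth_at_real_line_iff using D(1) by blast
qed

lemma smooth_at_imp_point: "smooth_at M N f p \<Longrightarrow> p \<in> points M"
  unfolding smooth_at_def using openin_subset by blast

lemma smooth_at_real_combine: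
  assumes M: "smooth_atlas M" and f: "smooth_at M real_line f p" and h: "smooth_at M real_line h p"
  shows "smooth_at M real_line (\<lambda>x. f x + h x) p" "smooth_at M real_line (\<lambda>x. f x * h x) p"
proof -
  obtain D \<phi> where D: "(D, \<phi>) \<in> charts M" "p \<in> D"
    by (rule charted_chart_at[OF smooth_atlas_charted[OF M] smooth_at_imp_point[OF f]])
  obtain V where V: "openin (mtop M) V" "p \<in> V" "V \<subseteq> D"
    "C_infinity (mdim M) (\<phi> ` V) (\<lambda>x. f (inv_into D \<phi> x))"
    using f unfolding smooth_at_real_in_chart[OF M D] by blast
  obtain V' where V': "openin (mtop M) V'" "p \<in> V'" "V' \<subseteq> D"
    "C_infinity (mdim M) (\<phi> ` V') (\<lambda>x. h (inv_into D \<phi> x))"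
    using h unfolding smooth_at_real_in_chart[OF M D] by blast
  have W: "openin (mtop M) (V \<inter> V')" "p \<in> V \<inter> V'" "V \<inter> V' \<subseteq> D" using V V' by auto
  have "C_infinity (mdim M) (\<phi> ` (V \<inter> V')) (\<lambda>x. f (inv_into D \<phi> x))"
    "C_infinity (mdim M) (\<phi> ` (V \<inter> V')) (\<lambda>x. h (inv_into D \<phi> x))"
    by (rule C_infinity_subset[OF V(4)], blast, rule C_infinity_subset[OF V'(4)], blast)
  from C_infinity_add[OF this] C_infinity_mult[OF this] W
  show "smooth_at M real_line (\<lambda>x. f x + h x) p" "smooth_at M real_line (\<lambda>x. f x * h x) p"
    unfolding smooth_at_real_in_chart[OF M D] by blast+
qed

lemma smooth_at_real_const:
  "smooth_atlas M \<Longrightarrow> p \<in> points M \<Longrightarrow> smooth_at M real_line (\<lambda>x. c) p"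
  using chartwise_imp_smooth_at[OF smooth_atlas_charted smooth_atlas_charted[OF smooth_atlas_real_line]
      chartwise_smooth_at_const[OF smooth_atlas_charted]]
  by (simp add: mtop_real_line)

lemma smooth_at_cong_near:
  assumes M: "smooth_atlas M" and f: "smooth_at M real_line f p"
    and V: "openin (mtop M) V" "p \<in> V" and eq: "\<And>x. x \<in> V \<Longrightarrow> f x = h x"
  shows "smooth_at M real_line h p"
proof -
  obtain D \<phi> where D: "(D, \<phi>) \<in> charts M" "p \<in> D"
    by (rule charted_chart_at[OF smooth_atlas_charted[OF M] smooth_at_imp_point[OF f]])
  note c = charted_is_chart[OF smooth_atlas_charted[OF M] D(1)]
  obtain V' where V': "openin (mtop M) V'" "p \<in> V'" "V' \<subseteq> D"
    and C: "C_infinity (mdim M) (\<phi> ` V') (\<lambda>x. f (inv_into D \<phi> x))"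
    using f unfolding smooth_at_real_in_chart[OF M D] by blast
  define W where "W = V \<inter> V'"
  have W: "openin (mtop M) W" "p \<in> W" "W \<subseteq> D" using V V' by (auto simp: W_def)
  have "C_infinity (mdim M) (\<phi> ` W) (\<lambda>x. h (inv_into D \<phi> x))"
  proof (rule C_infinity_cong)
    show "openin (Euclidean_space (mdim M)) (\<phi> ` W)"
      using is_chart_open_image[OF c W(3)] W(1) by simp
    show "C_infinity (mdim M) (\<phi> ` W) (\<lambda>x. f (inv_into D \<phi> x))"
      by (rule C_infinity_subset[OF C]) (auto simp: W_def)
    fix y assume "y \<in> \<phi> ` W"
    then obtain x where x: "x \<in> W" "y = \<phi> x" by blast
    then have "inv_into D \<phi> y = x" using W(3) is_chart_inj[OF c] by auto
    then show "f (inv_into D \<phi> y) = h (inv_into D \<phi> y)" using x eq by (simp add: W_def)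
  qed
  then show ?thesis unfolding smooth_at_real_in_chart[OF M D] using W by blast
qed

lemma tangent_spaceD:
  assumes "v \<in> tangent_space M p"
  shows "\<not> smooth_at M real_line f p \<Longrightarrow> v f = 0"
    and "smooth_at M real_line f p \<Longrightarrow> smooth_at M real_line h p \<Longrightarrow> v (\<lambda>x. f x + h x) = v f + v h"
    and "smooth_at M real_line f p \<Longrightarrow> smooth_at M real_line h p \<Longrightarrow>
      v (\<lambda>x. f x * h x) = f p * v h + h p * v f"
    and "smooth_at M real_line f p \<Longrightarrow> v (\<lambda>x. c * f x) = c * v f"
  using assms unfolding tangent_space_def by blast+

text \<open>
  If \<open>f - h\<close> vanishes on \<open>V\<close>, it is its own product with the indicator of the complement of \<open>V\<close>,
  which takes the place of a bump function. Both factors vanish at \<open>p\<close>, and both are smooth near \<open>p\<close>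
  because smoothness at a point only depends on a neighbourhood.
\<close>

lemma tangent_vector_local:
  assumes M: "smooth_atlas M" and v: "v \<in> tangent_space M p"
    and V: "openin (mtop M) V" "p \<in> V" and eq: "\<And>x. x \<in> V \<Longrightarrow> f x = h x"
  shows "v f = v h"
proof (cases "smooth_at M real_line f p")
  case False
  then have "\<not> smooth_at M real_line h p"
    using smooth_at_cong_near[OF M _ V, of h f] eq by auto
  with False show ?thesis by (simp add: tangent_spaceD(1)[OF v])
next
  case f: True
  then have h: "smooth_at M real_line h p" using smooth_at_cong_near[OF M _ V] eq by blast
  note p = smooth_at_imp_point[OF f]
  define u where "u x = f x + (- 1) * h x" for x
  define e where "e x = (if x \<in> V then 0 else 1 :: real)" for x
  have mh: "smooth_at M real_line (\<lambda>x. (- 1) * h x) p"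
    by (rule smooth_at_real_combine(2)[OF M smooth_at_real_const[OF M p] h])
  have u: "smooth_at M real_line u p"
    unfolding u_def by (rule smooth_at_real_combine(1)[OF M f mh])
  have e: "smooth_at M real_line e p"
    by (rule smooth_at_cong_near[OF M smooth_at_real_const[OF M p, of 0] V]) (simp add: e_def)
  have "u = (\<lambda>x. u x * e x)" using eq by (auto simp: u_def e_def)
  then have "v u = v (\<lambda>x. u x * e x)" by (rule arg_cong)
  also have "\<dots> = u p * v e + e p * v u" by (rule tangent_spaceD(3)[OF v u e])
  also have "\<dots> = 0" using V(2) eq by (simp add: u_def e_def)
  finally have "v u = 0" .
  moreover have "v u = v f + (- 1) * v h"
    unfolding u_def using tangent_spaceD(2)[OF v f mh] tangent_spaceD(4)[OF v h] by metis
  ultimately show ?thesis by simp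
qed

lemma tangent_map_in_tangent_space:
  assumes M: "smooth_atlas M" and N: "smooth_atlas N" and F: "smooth_at M N F p"
    and v: "v \<in> tangent_space M p"
  shows "tangent_map N F p v \<in> tangent_space N (F p)"
proof -
  let ?v = "tangent_map N F p v" and ?q = "F p"
  have c: "smooth_at M real_line (\<lambda>x. f (F x)) p" if "smooth_at N real_line f ?q" for f
    by (rule smooth_at_compose[OF M N F that])
  note add = smooth_at_real_combine(1)[OF N] and mult = smooth_at_real_combine(2)[OF N]
  have "?v f = 0" if "\<not> smooth_at N real_line f ?q" for f
    using that by (simp add: tangent_map_def)
  moreover have "?v (\<lambda>x. f x + h x) = ?v f + ?v h \<and> ?v (\<lambda>x. f x * h x) = f ?q * ?v h + h ?q * ?v f"
    if "smooth_at N real_line f ?q" "smooth_at N real_line h ?q" for f h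
    using tangent_spaceD(2,3)[OF v c[OF that(1)] c[OF that(2)]] that add[OF that] mult[OF that]
    by (simp add: tangent_map_def)
  moreover have "?v (\<lambda>x. c * f x) = c * ?v f" if f: "smooth_at N real_line f ?q" for c f
    using tangent_spaceD(4)[OF v c[OF f], of c] f
      mult[OF smooth_at_real_const[OF N smooth_at_imp_point[OF f]] f, of c]
    by (simp add: tangent_map_def)
  ultimately show ?thesis unfolding tangent_space_def by blast
qed

lemma lie_group_atlas: "lie_group G MG \<Longrightarrow> smooth_atlas MG"
  by (simp add: lie_group_def smooth_manifold_imp_atlas)

lemma smooth_at_translation:
  assumes G: "lie_group G MG" and g: "g \<in> carrier G" and x: "x \<in> carrier G"
  shows "smooth_at MG MG (\<lambda>y. g \<otimes>\<^bsub>G\<^esub> y) x" "smooth_at MG MG (\<lambda>y. y \<otimes>\<^bsub>G\<^esub> g) x"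
proof -
  note A = lie_group_atlas[OF G]
  note c = smooth_atlas_charted[OF A]
  have pts: "points MG = carrier G" using G by (simp add: lie_group_def)
  have mult: "smooth_at (prod_manifold MG MG) MG (\<lambda>(g, h). g \<otimes>\<^bsub>G\<^esub> h) z"
    if "z \<in> carrier G \<times> carrier G" for z
  proof -
    have "points (prod_manifold MG MG) = carrier G \<times> carrier G"
      by (simp add: prod_manifold_def pts)
    then show ?thesis using G that unfolding lie_group_def smooth_map_def by blast
  qed
  have id: "chartwise_smooth_at MG MG (\<lambda>y. y) x" and const: "chartwise_smooth_at MG MG (\<lambda>y. g) x"
    using chartwise_smooth_at_id[OF A] chartwise_smooth_at_const[OF c, of x g MG] pts g x by simp_all
  show "smooth_at MG MG (\<lambda>y. g \<otimes>\<^bsub>G\<^esub> y) x"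
    using smooth_at_compose_chartwise[OF c charted_prod[OF c c] chartwise_smooth_at_Pair[OF const id] mult]
      g x by simp
  show "smooth_at MG MG (\<lambda>y. y \<otimes>\<^bsub>G\<^esub> g) x"
    using smooth_at_compose_chartwise[OF c charted_prod[OF c c] chartwise_smooth_at_Pair[OF id const] mult]
      g x by simp
qed

lemma ltrans_inv_in_lie_algebra:
  assumes G: "lie_group G MG" and g: "g \<in> carrier G" and v: "v \<in> tangent_space MG g"
  shows "ltrans G MG (inv\<^bsub>G\<^esub> g) g v \<in> lie_algebra G MG"
proof -
  interpret group G using G by (simp add: lie_group_def)
  note A = lie_group_atlas[OF G]
  have "tangent_map MG (\<lambda>y. inv\<^bsub>G\<^esub> g \<otimes>\<^bsub>G\<^esub> y) g v \<in> tangent_space MG (inv\<^bsub>G\<^esub> g \<otimes>\<^bsub>G\<^esub> g)"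
    by (rule tangent_map_in_tangent_space[OF A A smooth_at_translation(1)[OF G inv_closed[OF g] g] v])
  then show ?thesis using g by (simp add: ltrans_def)
qed

text \<open>
  The translations involved satisfy \<open>(w y w\<^sup>-\<^sup>1)(w c) = (w y) c\<close>, hence \<open>(Ad\<^sub>w \<eta>) w c = w \<eta> c\<close>. The
  two functions of \<open>y\<close> only agree on the group, which is an open set of points.
\<close>

lemma rtrans_Ad:
  assumes G: "lie_group G MG" and w: "w \<in> carrier G" and c: "c \<in> carrier G"
    and \<eta>: "\<eta> \<in> lie_algebra G MG"
  shows "rtrans G MG \<one>\<^bsub>G\<^esub> (Ad G MG w \<eta>) (w \<otimes>\<^bsub>G\<^esub> c) = rtrans G MG w (ltrans G MG w \<one>\<^bsub>G\<^esub> \<eta>) c"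
proof
  fix f
  interpret group G using G by (simp add: lie_group_def)
  note A = lie_group_atlas[OF G]
  have pts: "points MG = carrier G" using G by (simp add: lie_group_def)
  show "rtrans G MG \<one>\<^bsub>G\<^esub> (Ad G MG w \<eta>) (w \<otimes>\<^bsub>G\<^esub> c) f = rtrans G MG w (ltrans G MG w \<one>\<^bsub>G\<^esub> \<eta>) c f"
  proof (cases "smooth_at MG real_line f (w \<otimes>\<^bsub>G\<^esub> c)")
    case True
    have "smooth_at MG real_line (\<lambda>y. f (y \<otimes>\<^bsub>G\<^esub> (w \<otimes>\<^bsub>G\<^esub> c))) \<one>\<^bsub>G\<^esub>"
      using True w c
      by (intro smooth_at_compose[OF A A smooth_at_translation(2)[OF G]]) auto
    moreover have "smooth_at MG real_line (\<lambda>y. f (y \<otimes>\<^bsub>G\<^esub> c)) w"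
      using True w c
      by (intro smooth_at_compose[OF A A smooth_at_translation(2)[OF G]]) auto
    moreover have "\<eta> (\<lambda>y. f (w \<otimes>\<^bsub>G\<^esub> y \<otimes>\<^bsub>G\<^esub> inv\<^bsub>G\<^esub> w \<otimes>\<^bsub>G\<^esub> (w \<otimes>\<^bsub>G\<^esub> c))) = \<eta> (\<lambda>y. f (w \<otimes>\<^bsub>G\<^esub> y \<otimes>\<^bsub>G\<^esub> c))"
    proof (rule tangent_vector_local[OF A \<eta>])
      show "openin (mtop MG) (carrier G)" unfolding pts[symmetric] by simp
      fix y assume "y \<in> carrier G"
      then show "f (w \<otimes>\<^bsub>G\<^esub> y \<otimes>\<^bsub>G\<^esub> inv\<^bsub>G\<^esub> w \<otimes>\<^bsub>G\<^esub> (w \<otimes>\<^bsub>G\<^esub> c)) = f (w \<otimes>\<^bsub>G\<^esub> y \<otimes>\<^bsub>G\<^esub> c)"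
        using w c by (simp add: m_assoc inv_solve_left flip: m_assoc[of "inv\<^bsub>G\<^esub> w"])
    qed simp
    ultimately show ?thesis
      using True w c by (simp add: rtrans_def ltrans_def Ad_def tangent_map_def)
  qed (use w c in \<open>simp add: rtrans_def tangent_map_def\<close>)
qed

section \<open>Summation by parts and the critical point condition\<close>

text \<open>
  The argument \<open>z\<close> of window \<open>n\<close> is the entry \<open>n + (z - c)\<close> of the sequence. The terms are collected
  by this entry \<open>j\<close>; it lies in the windows \<open>j + c - z\<close>, all of which are available when \<open>j\<close> is
  not one of the fixed entries at the ends.
\<close>

lemma sum_windows_by_entry:
  fixes Y :: "nat \<Rightarrow> nat \<Rightarrow> nat \<Rightarrow> 'a::comm_monoid_add"
  assumes Z: "\<And>z. z \<in> Z \<Longrightarrow> c \<le> z \<and> z - c \<le> k"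
    and zero: "\<And>z n. z \<in> Z \<Longrightarrow> n \<le> K \<Longrightarrow> n + (z - c) \<notin> {k..K} \<Longrightarrow> Y z n (n + (z - c)) = 0"
  shows "(\<Sum>n=0..K. \<Sum>z\<in>Z. Y z n (n + (z - c))) = (\<Sum>j=k..K. \<Sum>z\<in>Z. Y z (j + c - z) j)"
proof -
  have "(\<Sum>n=0..K. Y z n (n + (z - c))) = (\<Sum>j=k..K. Y z (j + c - z) j)" if z: "z \<in> Z" for z
  proof -
    let ?r = "\<lambda>j. j + c - z"
    have inj: "inj_on ?r {k..K}" using Z[OF z] by (auto simp: inj_on_def)
    have "(\<Sum>n=0..K. Y z n (n + (z - c))) = (\<Sum>n\<in>?r ` {k..K}. Y z n (n + (z - c)))"
    proof (rule sum.mono_neutral_right)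
      show "?r ` {k..K} \<subseteq> {0..K}" using Z[OF z] by auto
      show "\<forall>n\<in>{0..K} - ?r ` {k..K}. Y z n (n + (z - c)) = 0"
      proof
        fix n assume n: "n \<in> {0..K} - ?r ` {k..K}"
        have "n = ?r (n + (z - c))" using Z[OF z] by simp
        with n have "n + (z - c) \<notin> {k..K}" by (metis DiffD2 image_eqI)
        then show "Y z n (n + (z - c)) = 0" using zero[OF z] n by simp
      qed
    qed simp
    also have "\<dots> = (\<Sum>j=k..K. Y z (j + c - z) (j + c - z + (z - c)))"
      by (simp add: sum.reindex[OF inj])
    also have "\<dots> = (\<Sum>j=k..K. Y z (j + c - z) j)"
    proof (rule sum.cong)
      fix j assume "j \<in> {k..K}"
      then have "j + c - z + (z - c) = j" using Z[OF z] by auto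
      then show "Y z (j + c - z) (j + c - z + (z - c)) = Y z (j + c - z) j" by simp
    qed simp
    finally show ?thesis .
  qed
  then show ?thesis by (simp add: sum.swap[of _ Z])
qed

theorem theorem3p3:
  fixes G :: "'g monoid" and MG :: "'g manifold" and MQ :: "'q manifold"
    and act :: "'g \<Rightarrow> 'q \<Rightarrow> 'q" and MB :: "'q set manifold"
    and U :: "'q set set" and \<Phi> :: "'q set \<times> 'g \<Rightarrow> 'q" and \<A> :: "'q \<Rightarrow> 'q \<Rightarrow> 'g"
    and k m N :: nat
    and L :: "('q set, 'g) dpoint \<Rightarrow> real" and chi :: "nat \<Rightarrow> ('q set, 'g) dpoint \<Rightarrow> real"
    and p :: "nat \<Rightarrow> 'q set" and g :: "nat \<Rightarrow> 'g" and lam :: "nat \<Rightarrow> nat \<Rightarrow> real"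
    and MU A W AA a TL1 TL2 M eps
  defines "MU \<equiv> open_submanifold MB U"
    and "A \<equiv> local_connection G \<Phi> \<A>"
    and "W \<equiv> \<lambda>n. inv\<^bsub>G\<^esub> (g n) \<otimes>\<^bsub>G\<^esub> g (n + 1)"
    and "AA \<equiv> \<lambda>n. A (p n) (p (n + 1))"
    and "a \<equiv> window k p (\<lambda>n. W n \<otimes>\<^bsub>G\<^esub> AA n)"
    and "TL1 \<equiv> \<lambda>n (\<beta> :: 'g covector) \<delta>p. \<beta> (W_D1A G MG A (W n) (p n) (p (n + 1)) \<delta>p)"
    and "TL2 \<equiv> \<lambda>n (\<beta> :: 'g covector) \<delta>p. \<beta> (W_D2A G MG A (W n) (p n) (p (n + 1)) \<delta>p)"
    and "M \<equiv> \<lambda>n \<eta>. \<Sum>z=k+2..2*k+1.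
           D_group k z L (a (n + k + 2 - z)) (rtrans G MG \<one>\<^bsub>G\<^esub> \<eta> (W n \<otimes>\<^bsub>G\<^esub> AA n))"
    and "eps \<equiv> \<lambda>\<alpha> n z \<eta>.
           D_group k z (chi \<alpha>) (a (n + k + 2 - z)) (rtrans G MG \<one>\<^bsub>G\<^esub> \<eta> (W n \<otimes>\<^bsub>G\<^esub> AA n))"
  assumes principal: "principal_bundle G MG MQ act MB"
    and triv: "local_trivialization G MG MQ act MB U \<Phi>"
    and conn: "discrete_connection G MQ act \<A>"
    and A_smooth: "smooth_map (prod_manifold MU MU) MG (\<lambda>(p\<^sub>0, p\<^sub>1). A p\<^sub>0 p\<^sub>1)"
    and L_smooth: "smooth_map (reduced_space k MU MG) real_line L"
    and chi_smooth: "\<forall>\<alpha>\<in>{1..m}. smooth_map (reduced_space k MU MG) real_line (chi \<alpha>)"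
    and k: "1 \<le> k" and N: "k \<le> N"
    and q: "\<forall>n\<le>N. p n \<in> U \<and> g n \<in> carrier G"
    and horizontal: "\<forall>n\<in>{k..N - k}. \<forall>\<delta>p\<in>tangent_space MU (p n).
      0 = (\<Sum>i=1..k+1. D_base i L (a (n + 1 - i)) \<delta>p)
        + TL1 n (\<lambda>w. \<Sum>z=k+2..2*k+1. D_group k z L (a (n + k + 2 - z)) w) \<delta>p
        + TL2 (n - 1) (\<lambda>w. \<Sum>z=k+2..2*k+1. D_group k z L (a (n + k + 1 - z)) w) \<delta>p
        + (\<Sum>i=1..k+1. \<Sum>\<alpha>=1..m. lam (n + 1 - i) \<alpha> * D_base i (chi \<alpha>) (a (n + 1 - i)) \<delta>p)
        + TL1 n (\<lambda>w. \<Sum>z=k+2..2*k+1. \<Sum>\<alpha>=1..m.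
            lam (n + k + 2 - z) \<alpha> * D_group k z (chi \<alpha>) (a (n + k + 2 - z)) w) \<delta>p
        + TL2 (n - 1) (\<lambda>w. \<Sum>z=k+2..2*k+1. \<Sum>\<alpha>=1..m.
            lam (n + k + 1 - z) \<alpha> * D_group k z (chi \<alpha>) (a (n + k + 1 - z)) w) \<delta>p"
    and vertical: "\<forall>n\<in>{k..N - k}. \<forall>\<eta>\<in>lie_algebra G MG.
      M n \<eta> = Ad_star G MG (W (n - 1)) (M (n - 1)) \<eta>
        - (\<Sum>z=k+2..2*k+1. \<Sum>\<alpha>=1..m. lam (n + k + 2 - z) \<alpha> * eps \<alpha> n z \<eta>)
        + Ad_star G MG (W (n - 1)) (\<lambda>\<zeta>. \<Sum>z=k+2..2*k+1. \<Sum>\<alpha>=1..m.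
            lam (n + k + 1 - z) \<alpha> * eps \<alpha> (n - 1) z \<zeta>) \<eta>"
    and constraints: "\<forall>n\<le>N - k. \<forall>\<alpha>\<in>{1..m}. chi \<alpha> (a n) = 0"
  shows "critical_sequence G MG MU A k N m L chi p g lam"
proof -
  have G: "lie_group G MG" and MB: "smooth_manifold MB"
    using principal by (auto simp: principal_bundle_def)
  interpret group G using G by (simp add: lie_group_def)
  have aG: "smooth_atlas MG" by (rule lie_group_atlas[OF G])
  have U: "openin (mtop MB) U" using triv by (simp add: local_trivialization_def)
  have aU: "smooth_atlas MU"
    unfolding MU_def by (rule smooth_atlas_open_submanifold[OF smooth_manifold_imp_atlas[OF MB] U])
  have A_closed: "A x y \<in> carrier G" if "x \<in> U" "y \<in> U" for x y
  proof -
    have xy: "(x, y) \<in> points (prod_manifold MU MU)"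
      using that openin_subset[OF U] by (auto simp: prod_manifold_def MU_def open_submanifold_def)
    have "(\<lambda>(p\<^sub>0, p\<^sub>1). A p\<^sub>0 p\<^sub>1) \<in> points (prod_manifold MU MU) \<rightarrow> points MG"
      using A_smooth unfolding smooth_map_def by blast
    from funcset_mem[OF this xy] have "A x y \<in> points MG" by simp
    then show ?thesis using G by (simp add: lie_group_def)
  qed
  have W_closed: "W n \<in> carrier G" if "n < N" for n
    unfolding W_def using q that by simp
  have AA_closed: "AA n \<in> carrier G" if "n < N" for n
    unfolding AA_def using q that by (intro A_closed) auto
  define Z where "Z = {k + 2..2 * k + 1}"
  show ?thesis
    unfolding critical_sequence_def W_def[symmetric] Let_def
  proof (intro allI impI, elim conjE)
    fix \<delta>p \<delta>g \<eta> P H \<Lambda>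
    assume tangent: "\<forall>i\<le>N. \<delta>p i \<in> tangent_space MU (p i) \<and> \<delta>g i \<in> tangent_space MG (g i) \<and>
        \<eta> i = ltrans G MG (inv\<^bsub>G\<^esub> (g i)) (g i) (\<delta>g i)"
      and fixed: "\<forall>i\<le>N. i < k \<or> N - k < i \<longrightarrow> \<delta>p i = zero_tvector \<and> \<eta> i = zero_tvector"
      and P: "\<forall>i\<le>N. smooth_curve MU (P i) (p i) (\<delta>p i)"
      and H: "\<forall>i<N. smooth_curve MG (H i) (W i \<otimes>\<^bsub>G\<^esub> A (p i) (p (i + 1)))
        (group_variation G MG A (W i) (p i) (p (i + 1)) (\<eta> i) (\<eta> (i + 1)) (\<delta>p i) (\<delta>p (i + 1)))"
      and \<Lambda>: "\<forall>n\<le>N - k. \<forall>\<alpha>\<in>{1..m}. smooth_at real_line real_line (\<Lambda> n \<alpha>) 0 \<and> \<Lambda> n \<alpha> 0 = lam n \<alpha>"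
    define V where "V j = group_variation G MG A (W j) (p j) (p (j + 1)) (\<eta> j) (\<eta> (j + 1)) (\<delta>p j) (\<delta>p (j + 1))"
      for j
    let ?w = "\<lambda>n \<epsilon>. window k (\<lambda>i. P i \<epsilon>) (\<lambda>i. H i \<epsilon>) n"
    define dF where "dF F n = (\<Sum>i=1..k + 1. D_base i F (a n) (\<delta>p (n + (i - 1)))) +
      (\<Sum>z\<in>Z. D_group k z F (a n) (V (n + (z - (k + 2)))))" for F n
    have w0: "?w n 0 = a n" if n: "n \<le> N - k" for n
    proof -
      have "P (n + j) 0 = p (n + j)" if "j < k + 1" for j
        using P n N that by (auto simp: smooth_curve_def)
      moreover have "H (n + j) 0 = W (n + j) \<otimes>\<^bsub>G\<^esub> AA (n + j)" if "j < k" for j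
        using H n N that by (auto simp: smooth_curve_def AA_def)
      ultimately show ?thesis by (auto simp: a_def window_def fun_eq_iff)
    qed
    have dF: "((\<lambda>\<epsilon>. F (?w n \<epsilon>)) has_real_derivative dF F n) (at 0)"
      if F: "smooth_map (reduced_space k MU MG) real_line F" and n: "n \<le> N - k" for F n
    proof -
      have Ps: "smooth_at real_line MU (P (n + j)) 0" and Pv: "velocity MU (P (n + j)) = \<delta>p (n + j)"
        if "j < k + 1" for j
        using P n N that by (auto simp: smooth_curve_def)
      have Hs: "smooth_at real_line MG (H (n + j)) 0" and Hv: "velocity MG (H (n + j)) = V (n + j)"
        if "j < k" for j
        using H n N that by (auto simp: smooth_curve_def V_def)
      have "((\<lambda>\<epsilon>. F (?w n \<epsilon>)) has_real_derivative
          (\<Sum>i=1..k + 1. D_base i F (a n) (velocity MU (P (n + (i - 1))))) +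
          (\<Sum>z=k + 2..2 * k + 1. D_group k z F (a n) (velocity MG (H (n + (z - (k + 2))))))) (at 0)"
        using derivative_along_curves[OF aU aG F, of "\<lambda>j. P (n + j)" "\<lambda>j. H (n + j)"] Ps Hs
        unfolding w0[OF n, symmetric] window_def by simp
      also have "(\<Sum>i=1..k + 1. D_base i F (a n) (velocity MU (P (n + (i - 1))))) =
          (\<Sum>i=1..k + 1. D_base i F (a n) (\<delta>p (n + (i - 1))))"
        by (intro sum.cong refl) (subst Pv, auto)
      also have "(\<Sum>z=k + 2..2 * k + 1. D_group k z F (a n) (velocity MG (H (n + (z - (k + 2)))))) =
          (\<Sum>z\<in>Z. D_group k z F (a n) (V (n + (z - (k + 2)))))"
        unfolding Z_def by (intro sum.cong refl) (subst Hv, auto)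
      finally show ?thesis by (simp add: dF_def)
    qed
    (* The velocity of the multiplier is multiplied by the constraint, which vanishes at a n. *)
    have "((\<lambda>\<epsilon>. \<Lambda> n \<alpha> \<epsilon> * chi \<alpha> (?w n \<epsilon>)) has_real_derivative lam n \<alpha> * dF (chi \<alpha>) n) (at 0)"
      if n: "n \<le> N - k" and \<alpha>: "\<alpha> \<in> {1..m}" for n \<alpha>
    proof -
      obtain d where d: "(\<Lambda> n \<alpha> has_real_derivative d) (at 0)"
        using smooth_at_real_line_differentiable \<Lambda> n \<alpha> by metis
      have "smooth_map (reduced_space k MU MG) real_line (chi \<alpha>)" using chi_smooth \<alpha> by blast
      from DERIV_mult[OF d dF[OF this n]] show ?thesis
        using constraints \<Lambda> n \<alpha> by (simp add: w0 mult.commute)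
    qed
    then have "((\<lambda>\<epsilon>. action_sum k N m L chi (\<lambda>i. P i \<epsilon>) (\<lambda>i. H i \<epsilon>) (\<lambda>n \<alpha>. \<Lambda> n \<alpha> \<epsilon>))
        has_real_derivative (\<Sum>n=0..N - k. dF L n + (\<Sum>\<alpha>=1..m. lam n \<alpha> * dF (chi \<alpha>) n))) (at 0)"
      unfolding action_sum_def
      by (intro DERIV_sum DERIV_add dF[OF L_smooth]) auto
    moreover have "(\<Sum>n=0..N - k. dF L n + (\<Sum>\<alpha>=1..m. lam n \<alpha> * dF (chi \<alpha>) n)) = 0"
    proof -
      define B where "B i n v = D_base i L (a n) v + (\<Sum>\<alpha>=1..m. lam n \<alpha> * D_base i (chi \<alpha>) (a n) v)"
        for i n v
      define C where "C z n w = D_group k z L (a n) w + (\<Sum>\<alpha>=1..m. lam n \<alpha> * D_group k z (chi \<alpha>) (a n) w)"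
        for z n w
      (* V j varies with the entries j and j + 1. The four summands are indexed by the entry whose
         variation they contain, hence the shift by one in S and T2. *)
      define R where "R j = rtrans G MG \<one>\<^bsub>G\<^esub> (\<eta> j) (W j \<otimes>\<^bsub>G\<^esub> AA j)" for j
      define S where "S j = rtrans G MG (W (j - 1)) (ltrans G MG (W (j - 1)) \<one>\<^bsub>G\<^esub> (\<eta> j)) (AA (j - 1))" for j
      define T1 where "T1 j = W_D1A G MG A (W j) (p j) (p (j + 1)) (\<delta>p j)" for j
      define T2 where "T2 j = W_D2A G MG A (W (j - 1)) (p (j - 1)) (p j) (\<delta>p j)" for j
      have C_V: "C z n (V j) = - C z n (R j) + C z n (S (j + 1)) + C z n (T1 j) + C z n (T2 (j + 1))"
        for z n j
        by (simp add: C_def D_group_def V_def group_variation_def R_def S_def T1_def T2_def AA_def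
            algebra_simps sum.distrib sum_subtractf sum_negf)
      have fixed': "\<delta>p j = zero_tvector" "\<eta> j = zero_tvector" if "j \<le> N" "j \<notin> {k..N - k}" for j
        using fixed that by auto
      have C0: "C z n zero_tvector = 0" for z n
        by (simp add: C_def D_group_def)
      have B0: "B i n (\<delta>p j) = 0" and R0: "C z n (R j) = 0" and S0: "C z n (S j) = 0"
        and T10: "C z n (T1 j) = 0" and T20: "C z n (T2 j) = 0"
        if "j \<le> N" "j \<notin> {k..N - k}" for i z n j
        by (simp_all add: B_def C_def D_base_def D_group_def R_def S_def T1_def T2_def rtrans_def ltrans_def
            W_D1A_def W_D2A_def tangent_map_def fixed'[OF that])
      have Z: "k + 2 \<le> z \<and> z - (k + 2) \<le> k" "k + 1 \<le> z \<and> z - (k + 1) \<le> k" if "z \<in> Z" for z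
        using that by (auto simp: Z_def)
      have "(\<Sum>n=0..N - k. dF L n + (\<Sum>\<alpha>=1..m. lam n \<alpha> * dF (chi \<alpha>) n)) =
          (\<Sum>n=0..N - k. \<Sum>i=1..k + 1. B i n (\<delta>p (n + (i - 1)))) +
          (\<Sum>n=0..N - k. \<Sum>z\<in>Z. C z n (V (n + (z - (k + 2)))))"
        unfolding dF_def B_def C_def
        by (simp only: sum.distrib distrib_left sum_distrib_left sum.swap[of _ "{1..m}"] ac_simps)
      also have "(\<Sum>n=0..N - k. \<Sum>z\<in>Z. C z n (V (n + (z - (k + 2))))) =
          - (\<Sum>n=0..N - k. \<Sum>z\<in>Z. C z n (R (n + (z - (k + 2))))) +
          (\<Sum>n=0..N - k. \<Sum>z\<in>Z. C z n (S (n + (z - (k + 1))))) +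
          (\<Sum>n=0..N - k. \<Sum>z\<in>Z. C z n (T1 (n + (z - (k + 2))))) +
          (\<Sum>n=0..N - k. \<Sum>z\<in>Z. C z n (T2 (n + (z - (k + 1)))))"
      proof -
        have "n + (z - (k + 2)) + 1 = n + (z - (k + 1))" if "z \<in> Z" for n z
          using that by (auto simp: Z_def)
        then have "C z n (V (n + (z - (k + 2)))) = - C z n (R (n + (z - (k + 2)))) +
            C z n (S (n + (z - (k + 1)))) + C z n (T1 (n + (z - (k + 2)))) + C z n (T2 (n + (z - (k + 1))))"
          if "z \<in> Z" for n z
          using that unfolding C_V by metis
        then show ?thesis by (simp add: sum.distrib sum_negf sum_subtractf cong: sum.cong)
      qed
      also have "(\<Sum>n=0..N - k. \<Sum>i=1..k + 1. B i n (\<delta>p (n + (i - 1)))) =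
          (\<Sum>j=k..N - k. \<Sum>i=1..k + 1. B i (j + 1 - i) (\<delta>p j))"
        by (rule sum_windows_by_entry) (use N in \<open>auto intro!: B0\<close>)
      also have "(\<Sum>n=0..N - k. \<Sum>z\<in>Z. C z n (R (n + (z - (k + 2))))) =
          (\<Sum>j=k..N - k. \<Sum>z\<in>Z. C z (j + (k + 2) - z) (R j))"
        by (rule sum_windows_by_entry[OF Z(1)]) (use N in \<open>auto intro!: R0 simp: Z_def\<close>)
      also have "(\<Sum>n=0..N - k. \<Sum>z\<in>Z. C z n (S (n + (z - (k + 1))))) =
          (\<Sum>j=k..N - k. \<Sum>z\<in>Z. C z (j + (k + 1) - z) (S j))"
        by (rule sum_windows_by_entry[OF Z(2)]) (use N in \<open>auto intro!: S0 simp: Z_def\<close>)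
      also have "(\<Sum>n=0..N - k. \<Sum>z\<in>Z. C z n (T1 (n + (z - (k + 2))))) =
          (\<Sum>j=k..N - k. \<Sum>z\<in>Z. C z (j + (k + 2) - z) (T1 j))"
        by (rule sum_windows_by_entry[OF Z(1)]) (use N in \<open>auto intro!: T10 simp: Z_def\<close>)
      also have "(\<Sum>n=0..N - k. \<Sum>z\<in>Z. C z n (T2 (n + (z - (k + 1))))) =
          (\<Sum>j=k..N - k. \<Sum>z\<in>Z. C z (j + (k + 1) - z) (T2 j))"
        by (rule sum_windows_by_entry[OF Z(2)]) (use N in \<open>auto intro!: T20 simp: Z_def\<close>)
      also have "(\<Sum>j=k..N - k. \<Sum>i=1..k + 1. B i (j + 1 - i) (\<delta>p j)) +
          (- (\<Sum>j=k..N - k. \<Sum>z\<in>Z. C z (j + (k + 2) - z) (R j)) +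
           (\<Sum>j=k..N - k. \<Sum>z\<in>Z. C z (j + (k + 1) - z) (S j)) +
           (\<Sum>j=k..N - k. \<Sum>z\<in>Z. C z (j + (k + 2) - z) (T1 j)) +
           (\<Sum>j=k..N - k. \<Sum>z\<in>Z. C z (j + (k + 1) - z) (T2 j))) =
          (\<Sum>j=k..N - k. (\<Sum>i=1..k + 1. B i (j + 1 - i) (\<delta>p j)) +
            (\<Sum>z\<in>Z. C z (j + (k + 2) - z) (T1 j)) + (\<Sum>z\<in>Z. C z (j + (k + 1) - z) (T2 j)) +
            ((\<Sum>z\<in>Z. C z (j + (k + 1) - z) (S j)) - (\<Sum>z\<in>Z. C z (j + (k + 2) - z) (R j))))"
        by (simp add: sum.distrib sum_subtractf)
      also have "\<dots> = (\<Sum>j=k..N - k. 0)"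
      proof (rule sum.cong)
        fix j assume j: "j \<in> {k..N - k}"
        then have jN: "j \<le> N" "j - 1 < N" "j - 1 + 1 = j" using k N by auto
        have idx: "j + k + 2 = j + (k + 2)" "j + k + 1 = j + (k + 1)"
          "j - 1 + k + 2 = j + (k + 1)" using jN by auto
        have "\<delta>p j \<in> tangent_space MU (p j)" using tangent jN by blast
        from horizontal[rule_format, OF j this]
        have hor: "(\<Sum>i=1..k + 1. B i (j + 1 - i) (\<delta>p j)) + (\<Sum>z\<in>Z. C z (j + (k + 2) - z) (T1 j)) +
            (\<Sum>z\<in>Z. C z (j + (k + 1) - z) (T2 j)) = 0"
          unfolding TL1_def TL2_def idx jN(3) B_def C_def T1_def T2_def Z_def sum.distrib by linarith
        have \<eta>: "\<eta> j \<in> lie_algebra G MG"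
          using ltrans_inv_in_lie_algebra[OF G, of "g j" "\<delta>g j"] tangent jN q by auto
        have S: "rtrans G MG \<one>\<^bsub>G\<^esub> (Ad G MG (W (j - 1)) (\<eta> j)) (W (j - 1) \<otimes>\<^bsub>G\<^esub> AA (j - 1)) = S j"
          unfolding S_def by (rule rtrans_Ad[OF G W_closed[OF jN(2)] AA_closed[OF jN(2)] \<eta>])
        from vertical[rule_format, OF j \<eta>]
        have ver: "(\<Sum>z\<in>Z. C z (j + (k + 2) - z) (R j)) = (\<Sum>z\<in>Z. C z (j + (k + 1) - z) (S j))"
          unfolding M_def eps_def Ad_star_def S idx C_def R_def[symmetric] Z_def sum.distrib by linarith
        show "(\<Sum>i=1..k + 1. B i (j + 1 - i) (\<delta>p j)) +
            (\<Sum>z\<in>Z. C z (j + (k + 2) - z) (T1 j)) + (\<Sum>z\<in>Z. C z (j + (k + 1) - z) (T2 j)) +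
            ((\<Sum>z\<in>Z. C z (j + (k + 1) - z) (S j)) - (\<Sum>z\<in>Z. C z (j + (k + 2) - z) (R j))) = 0"
          using hor ver by linarith
      qed simp
      finally show ?thesis by simp
    qed
    ultimately show "((\<lambda>\<epsilon>. action_sum k N m L chi (\<lambda>i. P i \<epsilon>) (\<lambda>i. H i \<epsilon>) (\<lambda>n \<alpha>. \<Lambda> n \<alpha> \<epsilon>))
        has_real_derivative 0) (at 0)" by simp
  qed
qed

end
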